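(* Let $\mathcal{H}$ be a real Hilbert space, $n\ge 2$ an integer and $\beta>0$. Let $A_1,\ldots,A_n:\mathcal{H}\rightrightarrows\mathcal{H}$ be maximally monotone and let $B_1,\ldots,B_{n-1}:\mathcal{H}\to\mathcal{H}$ be $\beta$-cocoercive operators with $\operatorname{zer}\left(\sum_{i=1}^n A_i+\sum_{j=1}^{n-1}B_j\right)\neq\varnothing$. Let $G=(\mathcal{N},\mathcal{E})$, $G'=(\mathcal{N},\mathcal{E}')$ and $G''=(\mathcal{N},\mathcal{E}'')$ be directed graphs with node set $\mathcal{N}=\{1,\ldots,n\}$ such that: (1) $G$ is an algorithmic graph; (2) $\mathcal{E}'\subseteq\mathcal{E}$ and $G'$ is connected; (3) $\mathcal{E}''\subseteq\mathcal{E}$ and for every $i\in\{2,\ldots,n\}$ there is exactly one node, denoted $p(i)$, with $(p(i),i)\in\mathcal{E}''$. Let $d_i$ and $d_i^{\rm in}$ denote the degree and in-degree of node $i$ in $G$. Let $Z\in\mathbb{R}^{n\times(n-1)}$ satisfy $\operatorname{Lap}(G')=ZZ^\ast$. Let $\gamma\in{]0,4\beta[}$ and let $\{\theta_k\}_{k=0}^\infty$ be real numbers satisfying $$\theta_k\in\left]0,\tfrac{4\beta-\gamma}{2\beta}\right]\ \text{ for all } k,\qquad \sum_{k=0}^\infty\theta_k\left(\tfrac{4\beta-\gamma}{2\beta}-\theta_k\right)=+\infty.$$ Pick any $w_1^0,\ldots,w_{n-1}^0\in\mathcal{H}$ and define, for $k=0,1,2,\ldots$, $$x_1^{k+1}=J_{\frac{\gamma}{d_1}A_1}\left(\frac{1}{d_1}\sum_{j=1}^{n-1}Z_{1j}w_j^k\right),$$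 $$x_i^{k+1}=J_{\frac{\gamma}{d_i}A_i}\left(\frac{2}{d_i}\sum_{h:(h,i)\in\mathcal{E}}x_h^{k+1}-\frac{\gamma}{d_i}B_{i-1}\big(x_{p(i)}^{k+1}\big)+\frac{1}{d_i}\sum_{j=1}^{n-1}Z_{ij}w_j^k\right),\quad i=2,\ldots,n,$$ $$w_i^{k+1}=w_i^k-\theta_k\sum_{j=1}^n Z_{ji}x_j^{k+1},\quad i=1,\ldots,n-1.$$ Then: (i) for each $j=1,\ldots,n-1$ there is some $w_j^\ast\in\mathcal{H}$ such that $w_j^k\rightharpoonup w_j^\ast$ (weak convergence) as $k\to\infty$; (ii) there is $x^\ast\in\operatorname{zer}\left(\sum_{i=1}^n A_i+\sum_{j=1}^{n-1}B_j\right)$ such that $x_i^{k+1}\rightharpoonup x^\ast$ as $k\to\infty$ for all $i=1,\ldots,n$, and $$x^\ast=J_{\frac{\gamma}{d_1}A_1}\left(\frac{1}{d_1}\sum_{j=1}^{n-1}Z_{1j}w_j^\ast\right)=J_{\frac{\gamma}{d_i}A_i}\left(\frac{2d_i^{\rm in}}{d_i}x^\ast-\frac{\gamma}{d_i}B_{i-1}(x^\ast)+\frac{1}{d_i}\sum_{j=1}^{n-1}Z_{ij}w_j^\ast\right)\quad\text{for all } i=2,\ldots,n.$$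
   Context: For a set-valued operator $A:\mathcal{H}\rightrightarrows\mathcal{H}$, $\operatorname{zer}A=\{x: 0\in A(x)\}$ and the resolvent is $J_A=(\operatorname{Id}+A)^{-1}$ (single-valued with full domain when $A$ is maximally monotone). An operator $B:\mathcal{H}\to\mathcal{H}$ is $\beta$-cocoercive if $\langle B(x)-B(y),x-y\rangle\ge\beta\|B(x)-B(y)\|^2$ for all $x,y\in\mathcal{H}$. A (directed) graph is a pair $(\mathcal{N},\mathcal{E})$ with $\mathcal{N}$ finite and $\mathcal{E}\subseteq\mathcal{N}\times\mathcal{N}$. It is connected if any two distinct nodes are joined by a path when edge orientations are ignored. An algorithmic graph is a graph with $\mathcal{N}=\{1,\ldots,n\}$, $n\ge2$, such that $(i,j)\in\mathcal{E}$ implies $i<j$, and which is connected. The in-degree of $i$ is $|\{j:(j,i)\in\mathcal{E}\}|$, the out-degree is $|\{j:(i,j)\in\mathcal{E}\}|$, and the degree is their sum. The Laplacian $\operatorname{Lap}(G')\in\mathbb{R}^{n\times n}$ has $(i,i)$ entry equal to the degree of $i$ in $G'$, $(i,j)$ entry ($i\ne j$) equal to $-1$ if $(i,j)\in\mathcal{E}'$ or $(j,i)\in\mathcal{E}'$, and $0$ otherwise. A matrix $Z\in\mathbb{R}^{n\times(n-1)}$ with $\operatorname{Lap}(G')=ZZ^\ast$ is called an onto decomposition of $\operatorname{Lap}(G')$ (such $Z$ exists and has rank $n-1$). *)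

theory Defs
  imports
    "HOL-Analysis.Analysis"
    "Graph_Theory.Digraph_Component"
    "Jordan_Normal_Form.Matrix"
begin

section \<open>Set-valued operators\<close>

type_synonym 'a operator = "'a \<Rightarrow> 'a set"

text \<open>Sums of operators are pointwise Minkowski sums, i.e. the operations on sets provided by
  \<^theory>\<open>HOL-Library.Set_Algebras\<close>; in particular a sum is empty wherever one summand is.
  A single-valued operator \<open>B\<close> is viewed as the set-valued operator \<open>\<lambda>x. {B x}\<close>.\<close>

definition op_monotone :: "'a::real_inner operator \<Rightarrow> bool" where
  "op_monotone A \<longleftrightarrow> (\<forall>x y. \<forall>u\<in>A x. \<forall>v\<in>A y. inner (u - v) (x - y) \<ge> 0)"

definition maximally_monotone :: "'a::real_inner operator \<Rightarrow> bool" where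
  "maximally_monotone A \<longleftrightarrow>
     op_monotone A \<and> (\<forall>C. op_monotone C \<longrightarrow> (\<forall>x. A x \<subseteq> C x) \<longrightarrow> C = A)"

definition cocoercive :: "real \<Rightarrow> ('a::real_inner \<Rightarrow> 'a) \<Rightarrow> bool" where
  "cocoercive \<beta> B \<longleftrightarrow> (\<forall>x y. inner (B x - B y) (x - y) \<ge> \<beta> * (norm (B x - B y))\<^sup>2)"

definition zer :: "'a::zero operator \<Rightarrow> 'a set" where
  "zer A = {x. 0 \<in> A x}"

definition op_scale :: "real \<Rightarrow> 'a::real_vector operator \<Rightarrow> 'a operator" where
  "op_scale c A x = (\<lambda>u. c *\<^sub>R u) ` A x"

definition op_inverse :: "'a operator \<Rightarrow> 'a operator" where
  "op_inverse A u = {x. u \<in> A x}"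

definition resolvent_op :: "'a::ab_group_add operator \<Rightarrow> 'a operator" where
  "resolvent_op A = op_inverse (\<lambda>x. {x} + A x)"

text \<open>The set-valued resolvent read as a function: for maximally monotone \<open>A\<close> on a Hilbert space,
  every \<open>resolvent_op A z\<close> is a singleton (Minty), and \<open>resolvent A z\<close> is its element.\<close>

definition resolvent :: "'a::ab_group_add operator \<Rightarrow> 'a \<Rightarrow> 'a" where
  "resolvent A z = (THE x. x \<in> resolvent_op A z)"

definition weakly_tendsto :: "(nat \<Rightarrow> 'a::real_inner) \<Rightarrow> 'a \<Rightarrow> bool" where
  "weakly_tendsto u l \<longleftrightarrow> (\<forall>y. (\<lambda>k. inner (u k) y) \<longlonglongrightarrow> inner l y)"


section \<open>Algorithmic graphs\<close>

definition digraph_on :: "nat \<Rightarrow> nat pair_pre_digraph \<Rightarrow> bool" where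
  "digraph_on n G \<longleftrightarrow> pair_wf_digraph G \<and> pverts G = {1..n}"

text \<open>The constant \<open>Digraph_Component.connected\<close> already ignores the orientation of the arcs.\<close>

definition algorithmic_graph :: "nat \<Rightarrow> nat pair_pre_digraph \<Rightarrow> bool" where
  "algorithmic_graph n G \<longleftrightarrow>
     n \<ge> 2 \<and> digraph_on n G \<and> (\<forall>(i, j) \<in> parcs G. i < j) \<and>
     Digraph_Component.connected (with_proj G)"

definition node_degree :: "nat pair_pre_digraph \<Rightarrow> nat \<Rightarrow> nat" where
  "node_degree G i = in_degree (with_proj G) i + out_degree (with_proj G) i"

text \<open>Nodes are numbered from \<open>1\<close>, matrix indices from \<open>0\<close>: row (or column) \<open>i\<close> of the matrix
  belongs to node \<open>i + 1\<close>.\<close>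

definition Lap :: "nat \<Rightarrow> nat pair_pre_digraph \<Rightarrow> real mat" where
  "Lap n G = mat n n (\<lambda>(i, j).
     if i = j then real (node_degree G (i + 1))
     else if (i + 1, j + 1) \<in> parcs G \<or> (j + 1, i + 1) \<in> parcs G then - 1
     else 0)"

text \<open>The entry of a matrix in row \<open>i\<close> and column \<open>j\<close>, both counted from \<open>1\<close>.\<close>

abbreviation entry :: "real mat \<Rightarrow> nat \<Rightarrow> nat \<Rightarrow> real" where
  "entry Z i j \<equiv> Z $$ (i - 1, j - 1)"

definition onto_decomposition :: "nat \<Rightarrow> nat pair_pre_digraph \<Rightarrow> real mat \<Rightarrow> bool" where
  "onto_decomposition n G Z \<longleftrightarrow> Z \<in> carrier_mat n (n - 1) \<and> Lap n G = Z * transpose_mat Z"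

end

theory Submission
  imports Defs "Jordan_Normal_Form.Determinant"
begin

text \<open>Write the iteration as \<open>w (Suc k) = w k - \<theta> k Z\<^sup>* x\<close>, where \<open>x\<close> is computed from \<open>w k\<close> by one
  sweep through the nodes. Monotonicity of the \<open>A i\<close>, cocoercivity of the \<open>B j\<close>, and the identity
  \<open>\<parallel>Z\<^sup>* x\<parallel>\<^sup>2 = (\<Sum>(h, i)\<in>E'. \<parallel>x h - x i\<parallel>\<^sup>2)\<close> show that \<open>w \<mapsto> Z\<^sup>* x\<close> is cocoercive with constant
  \<open>(4 * \<beta> - \<gamma>) / (4 * \<beta>)\<close>. So the scheme is a relaxed Krasnoselskii-Mann iteration: it is Fejer
  monotone with respect to the zeros of \<open>w \<mapsto> Z\<^sup>* x\<close>, and \<open>Z\<^sup>* x\<close> tends to zero, hence by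
  connectedness of \<open>G'\<close> all nodes agree asymptotically. Demiclosedness of maximally monotone
  operators then makes every weak cluster point a solution, and Opial's argument leaves only one.
  Solutions exist because the range of \<open>Z\<close> consists of all vectors with zero sum.

  Weak cluster points are limits along filters finer than \<open>sequentially\<close>; these exist by
  Tychonoff's theorem and the Riesz representation. Minty's theorem and the Riesz representation
  both come from minimising \<open>\<parallel>z\<parallel>\<^sup>2 + c\<close> over a convex set of pairs \<open>(z, c)\<close>.\<close>

section \<open>Maximally monotone operators\<close>

text \<open>Minimise \<open>inner z z + c\<close> over \<open>C\<close>. The first components of a
  minimising sequence converge even if no minimum is attained in \<open>C\<close>, and the
  first-order optimality condition at their limit \<open>x\<close> is the claimed affine
  bound.\<close>

lemma quadratic_minorant:
  fixes C :: "('a::{real_inner,complete_space} \<times> real) set"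
  assumes conv: "convex C" and lower: "\<And>z c. (z, c) \<in> C \<Longrightarrow> m \<le> inner z z + c"
  shows "\<exists>x. \<forall>(z, c)\<in>C. m + inner x x \<le> 2 * inner x z + c"
proof (cases "C = {}")
  case False
  define h :: "'a \<times> real \<Rightarrow> real" where "h = (\<lambda>q. inner (fst q) (fst q) + snd q)"
  define \<mu> where "\<mu> = Inf (h ` C)"
  have bdd: "bdd_below (h ` C)"
    unfolding bdd_below_def using lower by (intro exI[of _ m]) (auto simp: h_def)
  have \<mu>_le: "\<mu> \<le> h q" if "q \<in> C" for q
    unfolding \<mu>_def using that by (intro cInf_lower bdd) auto
  have m_le: "m \<le> \<mu>"
    unfolding \<mu>_def using False lower by (intro cInf_greatest) (auto simp: h_def)
  have "\<exists>q\<in>C. h q < \<mu> + inverse (real (Suc n))" for n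
  proof -
    have "\<mu> < \<mu> + inverse (real (Suc n))" by simp
    then show ?thesis
      using cInf_lessD[of "h ` C" "\<mu> + inverse (real (Suc n))"] False unfolding \<mu>_def by blast
  qed
  then obtain q where q: "\<And>n. q n \<in> C" "\<And>n. h (q n) < \<mu> + inverse (real (Suc n))"
    by metis
  define z c where "z = (\<lambda>n. fst (q n))" and "c = (\<lambda>n. snd (q n))"
  \<comment> \<open>Midpoints stay in \<open>C\<close>, so \<open>h\<close> is at least
    \<open>\<mu>\<close> there; the parts of \<open>h\<close> linear in the second component
    cancel.\<close>
  have parallelogram: "inner (z i - z j) (z i - z j) \<le> 2 * h (q i) + 2 * h (q j) - 4 * \<mu>" for i j
  proof -
    have "(1/2) *\<^sub>R q i + (1/2) *\<^sub>R q j \<in> C"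
      by (rule convexD[OF conv q(1) q(1)]) auto
    then have "\<mu> \<le> h ((1/2) *\<^sub>R q i + (1/2) *\<^sub>R q j)" by (rule \<mu>_le)
    then show ?thesis
      unfolding h_def z_def
      by (simp add: inner_add_left inner_add_right inner_diff_left inner_diff_right
          inner_commute algebra_simps)
  qed
  have "Cauchy z"
  proof (rule metric_CauchyI)
    fix e :: real assume e: "0 < e"
    then obtain N where N: "inverse (real (Suc N)) < e\<^sup>2 / 4"
      using reals_Archimedean[of "e\<^sup>2 / 4"] by auto
    have "dist (z i) (z j) < e" if "i \<ge> N" "j \<ge> N" for i j
    proof -
      have "inverse (real (Suc i)) \<le> inverse (real (Suc N))"
        "inverse (real (Suc j)) \<le> inverse (real (Suc N))"
        using that by (auto intro!: le_imp_inverse_le)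
      then have "inner (z i - z j) (z i - z j) < e\<^sup>2"
        using parallelogram[of i j] q(2)[of i] q(2)[of j] N by linarith
      then have "(norm (z i - z j))\<^sup>2 < e\<^sup>2" by (simp add: power2_norm_eq_inner)
      then show ?thesis using e by (simp add: dist_norm power2_less_imp_less)
    qed
    then show "\<exists>M. \<forall>i\<ge>M. \<forall>j\<ge>M. dist (z i) (z j) < e" by blast
  qed
  then obtain x where x: "z \<longlonglongrightarrow> x"
    using Cauchy_convergent_iff convergent_def by blast
  have "(\<lambda>n. h (q n)) \<longlonglongrightarrow> \<mu>"
  proof (rule tendsto_sandwich)
    show "\<forall>\<^sub>F n in sequentially. \<mu> \<le> h (q n)"
      using \<mu>_le q(1) by simp
    show "\<forall>\<^sub>F n in sequentially. h (q n) \<le> \<mu> + inverse (real (Suc n))"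
      by (intro always_eventually allI less_imp_le q(2))
    show "(\<lambda>n. \<mu> + inverse (real (Suc n))) \<longlonglongrightarrow> \<mu>"
      using tendsto_add[OF tendsto_const LIMSEQ_inverse_real_of_nat, of \<mu>] by simp
  qed simp
  then have "(\<lambda>n. h (q n) - inner (z n) (z n)) \<longlonglongrightarrow> \<mu> - inner x x"
    by (rule tendsto_diff) (rule tendsto_inner[OF x x])
  then have c: "c \<longlonglongrightarrow> \<mu> - inner x x"
    by (simp add: h_def z_def c_def)
  have "m + inner x x \<le> 2 * inner x z' + c'" if C: "(z', c') \<in> C" for z' c'
  proof -
    \<comment> \<open>Move from \<open>q n\<close> towards \<open>(z', c')\<close> by a fraction
      \<open>t\<close>, let \<open>n\<close> tend to infinity and divide by \<open>t\<close>.
      Letting \<open>t\<close> tend to zero afterwards yields the optimality condition.\<close>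
    have le: "\<mu> \<le> - (1 - t) * inner x x + 2 * (1 - t) * inner x z' + t * inner z' z' + c'"
      if t: "0 < t" "t \<le> 1" for t :: real
    proof -
      have "(1 - t) *\<^sub>R q n + t *\<^sub>R (z', c') \<in> C" for n
        using t by (intro convexD[OF conv q(1) C]) auto
      then have *: "\<mu> \<le> h ((1 - t) *\<^sub>R q n + t *\<^sub>R (z', c'))" for n by (rule \<mu>_le)
      have "\<mu> \<le> inner ((1 - t) *\<^sub>R x + t *\<^sub>R z') ((1 - t) *\<^sub>R x + t *\<^sub>R z')
          + ((1 - t) * (\<mu> - inner x x) + t * c')"
      proof (rule LIMSEQ_le_const)
        show "(\<lambda>n. inner ((1 - t) *\<^sub>R z n + t *\<^sub>R z') ((1 - t) *\<^sub>R z n + t *\<^sub>R z')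
          + ((1 - t) * c n + t * c')) \<longlonglongrightarrow>
          inner ((1 - t) *\<^sub>R x + t *\<^sub>R z') ((1 - t) *\<^sub>R x + t *\<^sub>R z')
          + ((1 - t) * (\<mu> - inner x x) + t * c')"
          by (intro tendsto_intros x c)
      qed (use * in \<open>simp add: h_def z_def c_def\<close>)
      then have "t * \<mu> \<le> t * (- (1 - t) * inner x x + 2 * (1 - t) * inner x z'
          + t * inner z' z' + c')"
        by (simp add: inner_add_left inner_add_right inner_commute algebra_simps)
      then show ?thesis using t by simp
    qed
    have "\<mu> \<le> - (1 - 0) * inner x x + 2 * (1 - 0) * inner x z' + 0 * inner z' z' + c'"
    proof (rule LIMSEQ_le_const)
      show "(\<lambda>n. - (1 - inverse (real (Suc n))) * inner x x
          + 2 * (1 - inverse (real (Suc n))) * inner x z'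
          + inverse (real (Suc n)) * inner z' z' + c') \<longlonglongrightarrow>
          - (1 - 0) * inner x x + 2 * (1 - 0) * inner x z' + 0 * inner z' z' + c'"
        by (intro tendsto_intros LIMSEQ_inverse_real_of_nat)
      show "\<exists>N. \<forall>n\<ge>N. \<mu> \<le> - (1 - inverse (real (Suc n))) * inner x x
          + 2 * (1 - inverse (real (Suc n))) * inner x z'
          + inverse (real (Suc n)) * inner z' z' + c'"
        by (intro exI[of _ 0] allI impI le) (simp_all add: inverse_le_1_iff)
    qed
    then have "\<mu> \<le> - inner x x + 2 * inner x z' + c'" by simp
    then show ?thesis using m_le by linarith
  qed
  then show ?thesis by (intro exI[of _ x] ballI) (simp only: split_paired_all prod.case)
qed simp

text \<open>For the graph of \<open>\<lambda>y. - 2 * f y\<close> the quadratic minorant says that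
  \<open>inner x y - f y\<close> is bounded below, and a linear functional bounded below
  vanishes.\<close>

lemma riesz_representation:
  fixes f :: "'a::{real_inner,complete_space} \<Rightarrow> real"
  assumes lin: "linear f" and bound: "\<And>y. \<bar>f y\<bar> \<le> K * norm y"
  shows "\<exists>l. \<forall>y. f y = inner l y"
proof -
  define C where "C = range (\<lambda>y. (y, - 2 * f y))"
  have "linear (\<lambda>y. (y, - 2 * f y))"
    using lin by (intro linearI) (auto simp: linear_add linear_scale algebra_simps)
  then have "convex C"
    unfolding C_def by (intro convex_linear_image) auto
  moreover have "- (K\<^sup>2) \<le> inner z z + c" if "(z, c) \<in> C" for z c
  proof -
    have "2 * f z \<le> 2 * K * norm z" using bound[of z] by simp
    moreover have "0 \<le> (norm z - K)\<^sup>2" by simp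
    then have "2 * K * norm z \<le> (norm z)\<^sup>2 + K\<^sup>2" by (simp add: power2_diff algebra_simps)
    ultimately show ?thesis
      using that by (auto simp: C_def power2_norm_eq_inner)
  qed
  ultimately obtain x where x: "\<forall>(z, c)\<in>C. - (K\<^sup>2) + inner x x \<le> 2 * inner x z + c"
    using quadratic_minorant by blast
  define g where "g = (\<lambda>y. inner x y - f y)"
  have lower: "(- (K\<^sup>2) + inner x x) / 2 \<le> g y" for y
  proof -
    have "(y, - 2 * f y) \<in> C" by (simp add: C_def)
    then show ?thesis using x by (force simp: g_def)
  qed
  have scale: "g (t *\<^sub>R y) = t * g y" for t y
    using lin by (simp add: g_def linear_scale right_diff_distrib)
  have "g y = 0" for y
  proof (rule ccontr)
    assume nz: "g y \<noteq> 0"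
    define L where "L = (- (K\<^sup>2) + inner x x) / 2"
    \<comment> \<open>The multiple of \<open>y\<close> is chosen so that \<open>g\<close> would take
      the value \<open>L - 1\<close> there, below its lower bound \<open>L\<close>.\<close>
    have "L \<le> ((L - 1) / g y) * g y"
      using lower[of "((L - 1) / g y) *\<^sub>R y"] by (simp only: scale L_def)
    then show False using nz by simp
  qed
  then show ?thesis by (intro exI[of _ x]) (simp add: g_def)
qed

text \<open>The conclusion says that the pair \<open>(x, - x)\<close> may be added to
  \<open>S\<close>, which is the core of Minty's theorem. Expanded it reads
  \<open>inner x x \<le> inner x (y - v) + inner v y\<close>, an affine bound of the kind that
  quadratic minimisation provides.\<close>

lemma monotone_extension_point:
  fixes S :: "('a::{real_inner,complete_space} \<times> 'a) set"
  assumes mono: "\<And>y v y' v'. (y, v) \<in> S \<Longrightarrow> (y', v') \<in> S \<Longrightarrow> 0 \<le> inner (v - v') (y - y')"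
  shows "\<exists>x. \<forall>(y, v)\<in>S. 0 \<le> inner (v + x) (y - x)"
proof -
  \<comment> \<open>Monotonicity says that on the convex hull of these triples the third component dominates the
    inner product of the first two.\<close>
  define P where "P = (\<lambda>(y, v). (y, v, inner v y)) ` S"
  define Q where "Q = convex hull P"
  \<comment> \<open>The inequality is affine in each triple, so it passes from \<open>P\<close> to
    the hull in one argument and then, by symmetry, in the other. For two equal triples it says
    \<open>inner y v \<le> c\<close>.\<close>
  have half: "c - inner y v' - inner y' v + c' \<ge> 0"
    if Q1: "(y, v, c) \<in> Q" and Q2: "(y', v', c') \<in> Q" for y v c y' v' c'
  proof -
    have halfspace: "convex {(y, v, c). 0 \<le> c - inner y v' - inner y' v + c'}" for y' v' :: 'a and c'
      unfolding convex_def
      apply (clarsimp simp: inner_add_left inner_add_right)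
      subgoal for y v c y2 v2 c2 s t
        using mult_nonneg_nonneg[of s "c - inner y v' - inner y' v + c'"]
          mult_nonneg_nonneg[of t "c2 - inner y2 v' - inner y' v2 + c'"]
          distrib_right[of s t c']
        by (simp add: algebra_simps)
      done
    have "0 \<le> c - inner y v' - inner y' v + c'" if "(y', v', c') \<in> P" for y' v' c'
    proof -
      have "Q \<subseteq> {(y, v, c). 0 \<le> c - inner y v' - inner y' v + c'}"
        unfolding Q_def
      proof (rule hull_minimal)
        show "P \<subseteq> {(y, v, c). 0 \<le> c - inner y v' - inner y' v + c'}"
          using that mono
          by (fastforce simp: P_def inner_diff_left inner_diff_right inner_commute algebra_simps)
      qed (rule halfspace)
      then show ?thesis using Q1 by auto
    qed
    then have "P \<subseteq> {(y', v', c'). 0 \<le> c' - inner y' v - inner y v' + c}"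
      by (force simp: inner_commute)
    then have "Q \<subseteq> {(y', v', c'). 0 \<le> c' - inner y' v - inner y v' + c}"
      unfolding Q_def by (rule hull_minimal) (rule halfspace)
    then show ?thesis using Q2 by (auto simp: inner_commute)
  qed
  \<comment> \<open>The factor \<open>1/2\<close> makes \<open>inner z z + inner y v\<close> equal
    to \<open>inner (y + v) (y + v) / 4\<close>, hence the lower bound zero.\<close>
  define C where "C = (\<lambda>(y, v, c). ((1/2) *\<^sub>R (y - v), c)) ` Q"
  have "linear (\<lambda>(y::'a, v::'a, c::real). ((1/2) *\<^sub>R (y - v), c))"
    by (intro linearI) (auto simp: algebra_simps)
  then have "convex C"
    unfolding C_def by (rule convex_linear_image) (simp add: Q_def)
  moreover have "0 \<le> inner z z + c" if "(z, c) \<in> C" for z c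
  proof -
    obtain y v where yv: "(y, v, c) \<in> Q" "z = (1/2) *\<^sub>R (y - v)"
      using \<open>(z, c) \<in> C\<close> by (auto simp: C_def)
    have "inner y v \<le> c" using half[OF yv(1) yv(1)] by simp
    moreover have "0 \<le> inner (y + v) (y + v)" by simp
    ultimately show ?thesis
      by (simp add: yv(2) inner_add_left inner_add_right inner_diff_left inner_diff_right
          inner_commute field_simps)
  qed
  ultimately obtain x where x: "\<forall>(z, c)\<in>C. 0 + inner x x \<le> 2 * inner x z + c"
    using quadratic_minorant by blast
  have "0 \<le> inner (v + x) (y - x)" if "(y, v) \<in> S" for y v
  proof -
    have "(y, v, inner v y) \<in> Q"
      unfolding Q_def P_def using that by (intro hull_inc) force
    then have "((1/2) *\<^sub>R (y - v), inner v y) \<in> C" unfolding C_def by force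
    then have "inner x x \<le> 2 * inner x ((1/2) *\<^sub>R (y - v)) + inner v y" using x by auto
    then show ?thesis
      by (simp add: inner_add_left inner_add_right inner_diff_left inner_diff_right
          inner_commute algebra_simps)
  qed
  then show ?thesis by blast
qed

section \<open>Membership criterion, resolvents and cocoercive operators\<close>

lemma op_monotoneD:
  "op_monotone A \<Longrightarrow> u \<in> A x \<Longrightarrow> v \<in> A y \<Longrightarrow> 0 \<le> inner (u - v) (x - y)"
  unfolding op_monotone_def by blast

lemma inner_diff_flip: "0 \<le> inner (u - v) (x - y) \<Longrightarrow> 0 \<le> inner (v - u) (y - x)"
  by (simp add: inner_diff_left inner_diff_right)

text \<open>Adjoining \<open>u\<close> to \<open>A x\<close> gives a monotone extension of
  \<open>A\<close>, which by maximality is \<open>A\<close> itself.\<close>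

lemma maximally_monotone_mem:
  assumes A: "maximally_monotone A" and rel: "\<And>y v. v \<in> A y \<Longrightarrow> 0 \<le> inner (u - v) (x - y)"
  shows "u \<in> A x"
proof -
  define C where "C = (\<lambda>y. if y = x then insert u (A x) else A y)"
  have "op_monotone A" using A by (simp add: maximally_monotone_def)
  then have "op_monotone C"
    using rel rel[THEN inner_diff_flip] unfolding op_monotone_def C_def
    by (simp split: if_splits)
  moreover have "A y \<subseteq> C y" for y by (auto simp: C_def)
  ultimately have "C = A" using A unfolding maximally_monotone_def by blast
  moreover have "u \<in> C x" by (simp add: C_def)
  ultimately show ?thesis by simp
qed

lemma minty:
  fixes A :: "'a::{real_inner,complete_space} operator"
  assumes A: "maximally_monotone A" and c: "c > 0"
  shows "\<exists>x. \<exists>a\<in>A x. c *\<^sub>R a = z - x"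
proof -
  \<comment> \<open>The graph of \<open>A\<close>, scaled by \<open>c\<close> and shifted by
    \<open>z\<close>: the pair \<open>(x, - x)\<close> belongs to it exactly when
    \<open>z - x\<close> is \<open>c\<close> times an element of \<open>A x\<close>.\<close>
  define S where "S = {(y, c *\<^sub>R v - z) | y v. v \<in> A y}"
  have "\<exists>x. \<forall>(y, v)\<in>S. 0 \<le> inner (v + x) (y - x)"
  proof (rule monotone_extension_point)
    fix y v y' v' assume "(y, v) \<in> S" "(y', v') \<in> S"
    then obtain a a' where a: "a \<in> A y" "v = c *\<^sub>R a - z" "a' \<in> A y'" "v' = c *\<^sub>R a' - z"
      by (auto simp: S_def)
    then have "0 \<le> inner (a - a') (y - y')"
      using A op_monotoneD unfolding maximally_monotone_def by blast
    moreover have "inner (v - v') (y - y') = c * inner (a - a') (y - y')"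
      by (simp add: a flip: scaleR_right_diff_distrib)
    ultimately show "0 \<le> inner (v - v') (y - y')" using c by simp
  qed
  then obtain x where x: "\<forall>(y, v)\<in>S. 0 \<le> inner (v + x) (y - x)" by blast
  have "(1 / c) *\<^sub>R (z - x) \<in> A x"
  proof (rule maximally_monotone_mem[OF A])
    fix y v assume "v \<in> A y"
    then have "(y, c *\<^sub>R v - z) \<in> S" by (auto simp: S_def)
    then have "0 \<le> inner (c *\<^sub>R v - z + x) (y - x)" using x by blast
    also have "c *\<^sub>R v - z + x = - (c *\<^sub>R ((1 / c) *\<^sub>R (z - x) - v))"
      using c by (simp add: algebra_simps)
    also have "inner \<dots> (y - x) = c * inner ((1 / c) *\<^sub>R (z - x) - v) (x - y)"
      by (metis inner_minus_left inner_minus_right inner_scaleR_left minus_diff_eq)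
    finally show "0 \<le> inner ((1 / c) *\<^sub>R (z - x) - v) (x - y)"
      using c by (simp add: zero_le_mult_iff)
  qed
  moreover have "c *\<^sub>R (1 / c) *\<^sub>R (z - x) = z - x" using c by simp
  ultimately show ?thesis by blast
qed

text \<open>Turns the definite description into an inclusion, the form in which resolvents are used
  from here on. Existence is Minty's theorem; for uniqueness, monotonicity forces
  \<open>0 \<le> - (norm (y - y'))^2\<close> on two candidates.\<close>

lemma resolvent_eq_iff:
  fixes A :: "'a::{real_inner,complete_space} operator"
  assumes A: "maximally_monotone A" and c: "c > 0"
  shows "x = resolvent (op_scale c A) z \<longleftrightarrow> (\<exists>a\<in>A x. c *\<^sub>R a = z - x)"
proof -
  have mem: "y \<in> resolvent_op (op_scale c A) z \<longleftrightarrow> (\<exists>a\<in>A y. c *\<^sub>R a = z - y)" for y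
    by (auto simp: resolvent_op_def op_inverse_def op_scale_def set_plus_def image_iff algebra_simps)
  have unique: "y = y'" if "a \<in> A y" "c *\<^sub>R a = z - y" "a' \<in> A y'" "c *\<^sub>R a' = z - y'" for y y' a a'
  proof -
    have "0 \<le> c * inner (a - a') (y - y')"
      using A c that op_monotoneD unfolding maximally_monotone_def by fastforce
    also have "\<dots> = inner (c *\<^sub>R a - c *\<^sub>R a') (y - y')"
      by (simp flip: scaleR_right_diff_distrib)
    also have "c *\<^sub>R a - c *\<^sub>R a' = - (y - y')" using that by simp
    also have "inner \<dots> (y - y') = - ((norm (y - y'))\<^sup>2)" by (simp only: power2_norm_eq_inner inner_minus_left)
    finally show ?thesis by simp
  qed
  have "\<exists>!y. y \<in> resolvent_op (op_scale c A) z"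
    unfolding mem using minty[OF A c, of z] unique by blast
  then have "x = resolvent (op_scale c A) z \<longleftrightarrow> x \<in> resolvent_op (op_scale c A) z"
    unfolding resolvent_def using theI'[of "\<lambda>y. y \<in> resolvent_op (op_scale c A) z"] by auto
  then show ?thesis by (simp add: mem)
qed

lemma cocoercive_lipschitz:
  assumes "cocoercive \<beta> B"
  shows "\<beta> * norm (B x - B y) \<le> norm (x - y)"
proof (cases "B x = B y")
  case False
  have "\<beta> * (norm (B x - B y))\<^sup>2 \<le> inner (B x - B y) (x - y)"
    using assms by (simp add: cocoercive_def)
  also have "\<dots> \<le> norm (B x - B y) * norm (x - y)" by (rule norm_cauchy_schwarz)
  finally have "norm (B x - B y) * (\<beta> * norm (B x - B y)) \<le> norm (B x - B y) * norm (x - y)"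
    by (simp add: power2_eq_square mult.left_commute)
  then show ?thesis using False by simp
qed simp

text \<open>Puts the cocoercive operators on the same footing as the \<open>A i\<close> in the
  demiclosedness argument.\<close>

lemma cocoercive_maximally_monotone:
  assumes B: "cocoercive \<beta> B" and \<beta>: "\<beta> > 0"
  shows "maximally_monotone (\<lambda>x. {B x})"
  unfolding maximally_monotone_def
proof (intro conjI allI impI)
  have "0 \<le> inner (B x - B y) (x - y)" for x y
    using B \<beta> unfolding cocoercive_def by (meson mult_nonneg_nonneg order_trans zero_le_power2 less_imp_le)
  then show "op_monotone (\<lambda>x. {B x})" by (simp add: op_monotone_def)
  fix C assume C: "op_monotone C" "\<forall>x. {B x} \<subseteq> C x"
  have "u = B x" if u: "u \<in> C x" for u x
  proof -
    \<comment> \<open>Test monotonicity at a point moved from \<open>x\<close> in the direction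
      \<open>h\<close>. By the Lipschitz bound a step of \<open>\<beta> / 2\<close> changes
      \<open>B\<close> by at most \<open>norm h / 2\<close>, which forces
      \<open>h = 0\<close>.\<close>
    define h y where "h = u - B x" and "y = x + (\<beta> / 2) *\<^sub>R h"
    have "0 \<le> inner (u - B y) (x - y)"
      using C u by (intro op_monotoneD[of C]) auto
    also have "x - y = - ((\<beta> / 2) *\<^sub>R h)" by (simp add: y_def)
    also have "u - B y = h - (B y - B x)" by (simp add: h_def)
    finally have "inner h h \<le> inner (B y - B x) h"
      using \<beta> by (simp add: inner_diff_left mult_le_0_iff)
    also have "\<dots> \<le> norm (B y - B x) * norm h" by (rule norm_cauchy_schwarz)
    also have "norm (B y - B x) \<le> norm h / 2"
      using cocoercive_lipschitz[OF B, of y x] \<beta> by (simp add: y_def)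
    finally have "(norm h)\<^sup>2 \<le> (norm h)\<^sup>2 / 2"
      by (simp add: mult_right_mono power2_eq_square flip: power2_norm_eq_inner)
    then show ?thesis by (simp add: h_def)
  qed
  then show "C = (\<lambda>x. {B x})" using C(2) by (intro ext) blast
qed

section \<open>Weak convergence along filters\<close>

text \<open>Stated for arbitrary filters, so that finer filters can take the place of
  subsequences.\<close>

definition weak_limit :: "('i \<Rightarrow> 'a::real_inner) \<Rightarrow> 'a \<Rightarrow> 'i filter \<Rightarrow> bool" where
  "weak_limit u l F \<longleftrightarrow> (\<forall>y. ((\<lambda>k. inner (u k) y) \<longlongrightarrow> inner l y) F)"

lemma weak_limit_mono: "weak_limit u l F \<Longrightarrow> F' \<le> F \<Longrightarrow> weak_limit u l F'"
  unfolding weak_limit_def by (blast intro: tendsto_mono)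

lemma weak_limit_add:
  "weak_limit u l F \<Longrightarrow> weak_limit v m F \<Longrightarrow> weak_limit (\<lambda>k. u k + v k) (l + m) F"
  unfolding weak_limit_def by (simp add: inner_add_left tendsto_add)

lemma weak_limit_diff:
  "weak_limit u l F \<Longrightarrow> weak_limit v m F \<Longrightarrow> weak_limit (\<lambda>k. u k - v k) (l - m) F"
  unfolding weak_limit_def by (simp add: inner_diff_left tendsto_diff)

lemma weak_limit_scaleR: "weak_limit u l F \<Longrightarrow> weak_limit (\<lambda>k. c *\<^sub>R u k) (c *\<^sub>R l) F"
  unfolding weak_limit_def by (simp add: tendsto_mult_left)

lemma weak_limit_sum:
  "(\<And>i. i \<in> I \<Longrightarrow> weak_limit (u i) (l i) F) \<Longrightarrow>
    weak_limit (\<lambda>k. \<Sum>i\<in>I. u i k) (\<Sum>i\<in>I. l i) F"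
  unfolding weak_limit_def by (auto simp: inner_sum_left intro!: tendsto_sum)

lemma tendsto_imp_weak_limit: "(u \<longlongrightarrow> l) F \<Longrightarrow> weak_limit u l F"
  unfolding weak_limit_def by (auto intro: tendsto_inner)

lemma tendsto_inner_bounded_null:
  assumes u: "\<And>k. norm (u k) \<le> K" and v: "(v \<longlongrightarrow> 0) F"
  shows "((\<lambda>k. inner (u k) (v k)) \<longlongrightarrow> (0::real)) F"
proof (rule Lim_null_comparison)
  show "((\<lambda>k. K * norm (v k)) \<longlongrightarrow> 0) F"
    using tendsto_mult_left[OF tendsto_norm_zero[OF v], of K] by simp
  have "norm (inner (u k) (v k)) \<le> K * norm (v k)" for k
    using Cauchy_Schwarz_ineq2[of "u k" "v k"] mult_right_mono[OF u, of "norm (v k)" k] by simp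
  then show "\<forall>\<^sub>F k in F. norm (inner (u k) (v k)) \<le> K * norm (v k)" by simp
qed

text \<open>Weak compactness of balls: the functionals \<open>inner (u k)\<close> lie in a product
  of compact intervals, so they have a pointwise cluster point, which is linear and bounded and
  therefore represented by a vector.\<close>

lemma weak_limit_exists:
  fixes u :: "'i \<Rightarrow> 'a::{real_inner,complete_space}"
  assumes F: "F \<noteq> bot" and bound: "\<And>k. norm (u k) \<le> K"
  shows "\<exists>F' l. F' \<le> F \<and> F' \<noteq> bot \<and> weak_limit u l F'"
proof -
  define \<Phi> where "\<Phi> = (\<lambda>k y. inner (u k) y)"
  define S where "S = PiE UNIV (\<lambda>y::'a. {- (K * norm y)..K * norm y})"
  have "compactin (product_topology (\<lambda>_. euclidean) UNIV) S"
    unfolding S_def by (subst compactin_PiE) (simp add: compactin_euclidean_iff)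
  then have "compact S"
    by (simp add: euclidean_product_topology compactin_euclidean_iff)
  moreover have "\<bar>inner (u k) y\<bar> \<le> K * norm y" for k y
    using Cauchy_Schwarz_ineq2[of "u k" y] mult_right_mono[OF bound, of "norm y" k] by simp
  then have \<Phi>S: "\<Phi> k \<in> S" for k
    unfolding S_def \<Phi>_def by (auto simp: PiE_UNIV_domain abs_le_iff minus_le_iff)
  then have "eventually (\<lambda>x. x \<in> S) (filtermap \<Phi> F)" by (simp add: eventually_filtermap)
  ultimately obtain f where f: "f \<in> S" "inf (nhds f) (filtermap \<Phi> F) \<noteq> bot"
    unfolding compact_filter using F by (metis filtermap_bot_iff)
  \<comment> \<open>Restricting \<open>F\<close> to preimages of neighbourhoods of \<open>f\<close>
    makes \<open>\<Phi>\<close> converge to \<open>f\<close>; the result is proper because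
    \<open>f\<close> is a cluster point.\<close>
  define F' where "F' = inf (filtercomap \<Phi> (nhds f)) F"
  have "F' \<noteq> bot"
  proof
    assume "F' = bot"
    then have "eventually (\<lambda>_. False) (inf (filtercomap \<Phi> (nhds f)) F)"
      unfolding F'_def by simp
    then obtain P Q where PQ: "eventually P (filtercomap \<Phi> (nhds f))" "eventually Q F"
      "\<And>k. \<not> (P k \<and> Q k)"
      unfolding eventually_inf by blast
    then obtain R where R: "eventually R (nhds f)" "\<And>k. R (\<Phi> k) \<Longrightarrow> P k"
      unfolding eventually_filtercomap by blast
    have "eventually (\<lambda>z. \<not> R z) (filtermap \<Phi> F)"
      unfolding eventually_filtermap using PQ(2) by eventually_elim (use PQ(3) R(2) in blast)
    then have "eventually (\<lambda>_. False) (inf (nhds f) (filtermap \<Phi> F))"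
      unfolding eventually_inf using R(1) by blast
    then show False using f(2) by (simp add: eventually_False)
  qed
  have "(\<Phi> \<longlongrightarrow> f) F'"
    unfolding F'_def by (rule tendsto_mono[OF inf_le1]) (rule filterlim_filtercomap)
  then have lim: "((\<lambda>k. inner (u k) y) \<longlongrightarrow> f y) F'" for y
  proof -
    have "((\<lambda>g. g y) \<longlongrightarrow> f y) (at f)"
      using continuous_on_product_coordinates[of y] by (auto simp: continuous_on_def)
    from tendsto_compose[OF this \<open>(\<Phi> \<longlongrightarrow> f) F'\<close>] show ?thesis by (simp add: \<Phi>_def)
  qed
  have "linear f"
  proof (rule linearI)
    show "f (x + y) = f x + f y" for x y
      using tendsto_unique[OF \<open>F' \<noteq> bot\<close> lim[of "x + y"]] tendsto_add[OF lim[of x] lim[of y]]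
      by (simp add: inner_add_right)
    show "f (c *\<^sub>R x) = c *\<^sub>R f x" for c x
      using tendsto_unique[OF \<open>F' \<noteq> bot\<close> lim[of "c *\<^sub>R x"]] tendsto_mult_left[OF lim[of x], of c]
      by simp
  qed
  moreover have "\<bar>f y\<bar> \<le> K * norm y" for y
    using f(1) by (auto simp: S_def PiE_UNIV_domain abs_le_iff minus_le_iff)
  ultimately obtain l where "\<forall>y. f y = inner l y" using riesz_representation by blast
  then have "weak_limit u l F'" using lim by (simp add: weak_limit_def)
  moreover have "F' \<le> F" by (simp add: F'_def)
  ultimately show ?thesis using \<open>F' \<noteq> bot\<close> by blast
qed

text \<open>Refine the filter one index at a time; limits already obtained survive
  refinement.\<close>

lemma weak_limit_exists_finite:
  fixes u :: "'j \<Rightarrow> 'i \<Rightarrow> 'a::{real_inner,complete_space}"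
  assumes "finite I" and F: "F \<noteq> bot" and bound: "\<And>i k. i \<in> I \<Longrightarrow> norm (u i k) \<le> K i"
  shows "\<exists>F' l. F' \<le> F \<and> F' \<noteq> bot \<and> (\<forall>i\<in>I. weak_limit (u i) (l i) F')"
  using \<open>finite I\<close> bound
proof (induction I)
  case empty
  then show ?case using F by blast
next
  case (insert j I)
  then obtain F1 l1 where 1: "F1 \<le> F" "F1 \<noteq> bot" "\<forall>i\<in>I. weak_limit (u i) (l1 i) F1"
    by auto
  obtain F2 l where 2: "F2 \<le> F1" "F2 \<noteq> bot" "weak_limit (u j) l F2"
    using weak_limit_exists[OF 1(2), of "u j"] insert.prems by blast
  have "\<forall>i\<in>insert j I. weak_limit (u i) ((l1(j := l)) i) F2"
    using 1(3) 2(3) insert.hyps(2) weak_limit_mono[OF _ 2(1)] by auto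
  then show ?case using 1(1) 2(1,2) order_trans by blast
qed

text \<open>The subsequence principle for filters: if convergence failed, the values would stay
  \<open>e\<close> away from the limit along some proper filter, and no refinement of it could
  converge.\<close>

lemma weakly_tendstoI_subfilter:
  assumes "\<And>F. F \<le> sequentially \<Longrightarrow> F \<noteq> bot \<Longrightarrow> \<exists>F'\<le>F. F' \<noteq> bot \<and> weak_limit u l F'"
  shows "weakly_tendsto u l"
  unfolding weakly_tendsto_def
proof (intro allI, rule ccontr)
  fix y
  assume "\<not> (\<lambda>k. inner (u k) y) \<longlonglongrightarrow> inner l y"
  then obtain e where e: "e > 0" "\<not> (\<forall>\<^sub>F k in sequentially. dist (inner (u k) y) (inner l y) < e)"
    unfolding tendsto_iff by blast
  define P where "P = (\<lambda>k. \<not> dist (inner (u k) y) (inner l y) < e)"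
  define F where "F = inf sequentially (principal {k. P k})"
  have "F \<noteq> bot"
  proof
    assume "F = bot"
    then have "eventually (\<lambda>_. False) F" by simp
    then show False using e(2) unfolding F_def eventually_inf_principal by (simp add: P_def)
  qed
  moreover have "F \<le> sequentially" by (simp add: F_def)
  ultimately obtain F' where F': "F' \<le> F" "F' \<noteq> bot" "weak_limit u l F'"
    using assms by blast
  then have "\<forall>\<^sub>F k in F'. dist (inner (u k) y) (inner l y) < e"
    using e(1) unfolding weak_limit_def tendsto_iff by blast
  moreover have "eventually P F"
    unfolding F_def eventually_inf_principal by simp
  then have "eventually P F'" using F'(1) by (rule filter_leD[rotated])
  ultimately have "eventually (\<lambda>_. False) F'" by eventually_elim (simp add: P_def)
  then show False using F'(2) by (simp add: eventually_False)
qed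

text \<open>Demiclosedness of the product of the \<open>M i\<close>. The pairings are required to
  converge only in sum, which is what a balance over all nodes can supply.\<close>

lemma maximally_monotone_demiclosed:
  assumes I: "finite I" and M: "\<And>i. i \<in> I \<Longrightarrow> maximally_monotone (M i)" and F: "F \<noteq> bot"
    and mem: "\<And>i k. i \<in> I \<Longrightarrow> u i k \<in> M i (z i k)"
    and u: "\<And>i. i \<in> I \<Longrightarrow> weak_limit (u i) (u' i) F"
    and z: "\<And>i. i \<in> I \<Longrightarrow> weak_limit (z i) (z' i) F"
    and sum: "((\<lambda>k. \<Sum>i\<in>I. inner (u i k) (z i k)) \<longlongrightarrow> (\<Sum>i\<in>I. inner (u' i) (z' i))) F"
    and j: "j \<in> I"
  shows "u' j \<in> M j (z' j)"
proof (rule ccontr)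
  assume nmem: "u' j \<notin> M j (z' j)"
  \<comment> \<open>Every component gets a test pair with nonpositive pairing: a violating pair
    where membership fails, the limit pair itself where it holds. Their sum is negative, yet it is a
    limit of nonnegative sums.\<close>
  have "\<exists>y v. v \<in> M i y \<and> inner (u' i - v) (z' i - y) \<le> 0 \<and>
      (u' i \<notin> M i (z' i) \<longrightarrow> inner (u' i - v) (z' i - y) < 0)" if i: "i \<in> I" for i
  proof (cases "u' i \<in> M i (z' i)")
    case True
    then show ?thesis by (intro exI[of _ "z' i"] exI[of _ "u' i"]) simp
  next
    case False
    then show ?thesis using maximally_monotone_mem[OF M[OF i]] by (meson linorder_not_le less_imp_le)
  qed
  then obtain y v where yv: "\<And>i. i \<in> I \<Longrightarrow> v i \<in> M i (y i)"
    "\<And>i. i \<in> I \<Longrightarrow> inner (u' i - v i) (z' i - y i) \<le> 0"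
    "\<And>i. i \<in> I \<Longrightarrow> u' i \<notin> M i (z' i) \<Longrightarrow> inner (u' i - v i) (z' i - y i) < 0"
    by metis
  have "(\<Sum>i\<in>I. inner (u' i - v i) (z' i - y i)) < (\<Sum>i\<in>I. 0)"
    using yv(2,3) nmem j by (intro sum_strict_mono_ex1[OF I]) auto
  moreover have "((\<lambda>k. (\<Sum>i\<in>I. inner (u i k) (z i k)) - (\<Sum>i\<in>I. inner (u i k) (y i))
      - (\<Sum>i\<in>I. inner (z i k) (v i)) + (\<Sum>i\<in>I. inner (v i) (y i))) \<longlongrightarrow>
      (\<Sum>i\<in>I. inner (u' i) (z' i)) - (\<Sum>i\<in>I. inner (u' i) (y i))
      - (\<Sum>i\<in>I. inner (z' i) (v i)) + (\<Sum>i\<in>I. inner (v i) (y i))) F"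
    using u z by (intro tendsto_add tendsto_diff tendsto_sum tendsto_const sum) (auto simp: weak_limit_def)
  then have "((\<lambda>k. \<Sum>i\<in>I. inner (u i k - v i) (z i k - y i)) \<longlongrightarrow>
      (\<Sum>i\<in>I. inner (u' i - v i) (z' i - y i))) F"
    by (simp add: inner_diff_left inner_diff_right sum_subtractf sum.distrib inner_commute
        algebra_simps)
  then have "0 \<le> (\<Sum>i\<in>I. inner (u' i - v i) (z' i - y i))"
  proof (rule tendsto_lowerbound[OF _ _ F])
    have "0 \<le> (\<Sum>i\<in>I. inner (u i k - v i) (z i k - y i))" for k
      using M mem yv(1) by (intro sum_nonneg) (auto simp: maximally_monotone_def op_monotone_def)
    then show "\<forall>\<^sub>F k in F. 0 \<le> (\<Sum>i\<in>I. inner (u i k - v i) (z i k - y i))" by simp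
  qed
  ultimately show False by simp
qed

section \<open>Graph Laplacians\<close>

text \<open>Connectedness as an induction rule: a walk that may follow arcs backwards chains
  \<open>R\<close> together.\<close>

lemma connected_arc_induct:
  assumes conn: "Digraph_Component.connected (with_proj G)"
    and refl: "\<And>a. R a a" and sym: "\<And>a b. R a b \<Longrightarrow> R b a"
    and trans: "\<And>a b c. R a b \<Longrightarrow> R b c \<Longrightarrow> R a c"
    and arc: "\<And>a b. (a, b) \<in> parcs G \<Longrightarrow> R a b"
    and uv: "u \<in> pverts G" "v \<in> pverts G"
  shows "R u v"
proof -
  let ?S = "mk_symmetric (with_proj G)"
  have "u \<rightarrow>\<^sup>*\<^bsub>with_proj ?S\<^esub> v"
    using conn uv unfolding Digraph_Component.connected_def by (elim strongly_connectedE) simp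
  then have "(u, v) \<in> (arcs_ends (with_proj ?S))\<^sup>*"
    unfolding reachable_def by (rule rtrancl_on_rtranclI)
  then have "(u, v) \<in> (parcs ?S)\<^sup>*" by (simp add: arcs_ends_conv)
  then show ?thesis
  proof (induction rule: rtrancl_induct)
    case (step b c)
    then have "(b, c) \<in> parcs G \<or> (c, b) \<in> parcs G"
      by (auto simp: parcs_mk_symmetric)
    then show ?case using step.IH arc sym trans by blast
  qed (rule refl)
qed

lemma sum_in_arcs:
  fixes f :: "'a \<Rightarrow> 'a \<Rightarrow> 'b::comm_monoid_add"
  assumes "finite V" "E \<subseteq> V \<times> V"
  shows "(\<Sum>i\<in>V. \<Sum>h | (h, i) \<in> E. f h i) = (\<Sum>(h, i)\<in>E. f h i)"
proof -
  have "(\<Sum>i\<in>V. \<Sum>h | (h, i) \<in> E. f h i) = (\<Sum>(i, h)\<in>Sigma V (\<lambda>i. {h. (h, i) \<in> E}). f h i)"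
    using assms by (intro sum.Sigma) (auto intro: finite_subset[of _ V])
  also have "\<dots> = (\<Sum>(h, i)\<in>E. f h i)"
    using assms by (intro sum.reindex_bij_witness[of _ prod.swap prod.swap]) auto
  finally show ?thesis .
qed

lemma sum_out_arcs:
  fixes f :: "'a \<Rightarrow> 'a \<Rightarrow> 'b::comm_monoid_add"
  assumes "finite V" "E \<subseteq> V \<times> V"
  shows "(\<Sum>i\<in>V. \<Sum>h | (i, h) \<in> E. f i h) = (\<Sum>(i, h)\<in>E. f i h)"
proof -
  have "(\<Sum>i\<in>V. \<Sum>h | (i, h) \<in> E. f i h) = (\<Sum>(i, h)\<in>Sigma V (\<lambda>i. {h. (i, h) \<in> E}). f i h)"
    using assms by (intro sum.Sigma) (auto intro: finite_subset[of _ V])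
  also have "Sigma V (\<lambda>i. {h. (i, h) \<in> E}) = E" using assms by auto
  finally show ?thesis .
qed

lemma in_degree_with_proj: "in_degree (with_proj G) i = card {h. (h, i) \<in> parcs G}"
proof -
  have "in_arcs (with_proj G) i = (\<lambda>h. (h, i)) ` {h. (h, i) \<in> parcs G}"
    by (auto simp: in_arcs_def)
  then show ?thesis unfolding in_degree_def by (simp add: card_image inj_on_def)
qed

lemma out_degree_with_proj: "out_degree (with_proj G) i = card {h. (i, h) \<in> parcs G}"
proof -
  have "out_arcs (with_proj G) i = Pair i ` {h. (i, h) \<in> parcs G}"
    by (auto simp: out_arcs_def)
  then show ?thesis unfolding out_degree_def by (simp add: card_image inj_on_def)
qed

text \<open>Handshake count: an arc is seen once by the in-degree of its head and once by the
  out-degree of its tail.\<close>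

lemma sum_node_degree:
  fixes g :: "nat \<Rightarrow> 'a::real_vector"
  assumes "finite V" "parcs G \<subseteq> V \<times> V"
  shows "(\<Sum>i\<in>V. real (node_degree G i) *\<^sub>R g i) = (\<Sum>(h, i)\<in>parcs G. g h + g i)"
proof -
  have "(\<Sum>i\<in>V. real (node_degree G i) *\<^sub>R g i) =
      (\<Sum>i\<in>V. \<Sum>h | (h, i) \<in> parcs G. g i) + (\<Sum>i\<in>V. \<Sum>h | (i, h) \<in> parcs G. g i)"
    by (simp add: node_degree_def in_degree_with_proj out_degree_with_proj scaleR_add_left
        sum.distrib sum_constant_scaleR)
  also have "\<dots> = (\<Sum>(h, i)\<in>parcs G. g i) + (\<Sum>(h, i)\<in>parcs G. g h)"
    using sum_in_arcs[OF assms, of "\<lambda>h i. g i"] sum_out_arcs[OF assms, of "\<lambda>i h. g i"] by simp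
  also have "\<dots> = (\<Sum>(h, i)\<in>parcs G. g h + g i)"
    by (simp add: case_prod_unfold sum.distrib add.commute)
  finally show ?thesis .
qed

lemma digraph_on_arcs: "digraph_on n G \<Longrightarrow> parcs G \<subseteq> {1..n} \<times> {1..n}"
  unfolding digraph_on_def using pair_wf_digraph.wellformed' by fastforce

lemma node_degree_pos:
  assumes G: "algorithmic_graph n G" and i: "i \<in> {1..n}"
  shows "node_degree G i > 0"
proof (rule ccontr)
  assume "\<not> node_degree G i > 0"
  moreover have sub: "parcs G \<subseteq> {1..n} \<times> {1..n}"
    using G digraph_on_arcs by (simp add: algorithmic_graph_def)
  have "finite {h. (h, i) \<in> parcs G}" "finite {h. (i, h) \<in> parcs G}"
    using sub by (auto intro!: finite_subset[of _ "{1..n}"])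
  ultimately have iso: "(h, i) \<notin> parcs G" "(i, h) \<notin> parcs G" for h
    by (auto simp: node_degree_def in_degree_with_proj out_degree_with_proj)
  define j :: nat where "j = (if i = 1 then 2 else 1)"
  have j: "j \<in> {1..n}" "j \<noteq> i"
    using G i by (auto simp: algorithmic_graph_def j_def)
  \<comment> \<open>No arc meets \<open>i\<close>, so being equal to \<open>i\<close> is invariant
    along arcs, and connectedness would carry it to \<open>j\<close>.\<close>
  have "(i = i) = (j = i)"
  proof (rule connected_arc_induct[where G = G and R = "\<lambda>a b. (a = i) = (b = i)"])
    show "(a = i) = (b = i)" if "(a, b) \<in> parcs G" for a b using that iso by blast
  qed (use G i j in \<open>auto simp: algorithmic_graph_def digraph_on_def\<close>)
  then show False using j by simp
qed

text \<open>Orientation excludes loops and antiparallel arcs, for which \<open>Lap\<close> would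
  differ from the quadratic form of arc differences.\<close>

locale laplacian_decomposition =
  fixes n :: nat and G :: "nat pair_pre_digraph" and Z :: "real mat"
  assumes digraph: "digraph_on n G" and oriented: "\<And>i j. (i, j) \<in> parcs G \<Longrightarrow> i < j"
    and connected: "Digraph_Component.connected (with_proj G)"
    and decomposition: "onto_decomposition n G Z"
begin

lemma arcs_subset: "parcs G \<subseteq> {1..n} \<times> {1..n}"
  by (rule digraph_on_arcs[OF digraph])

lemma finite_arcs: "finite (parcs G)"
  using arcs_subset finite_subset by blast

text \<open>The Laplacian as a quadratic form; a general \<open>g\<close> covers inner products of
  vectors as well as products of reals.\<close>

lemma sum_Lap:
  fixes g :: "nat \<Rightarrow> nat \<Rightarrow> real"
  shows "(\<Sum>i=1..n. \<Sum>j=1..n. entry (Lap n G) i j * g i j) =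
    (\<Sum>(h, i)\<in>parcs G. g h h + g i i - g h i - g i h)"
proof -
  have entry_eq: "entry (Lap n G) i j * g i j = (if j = i then real (node_degree G i) * g i i else 0)
      - (if (i, j) \<in> parcs G then g i j else 0) - (if (j, i) \<in> parcs G then g i j else 0)"
    if "i \<in> {1..n}" "j \<in> {1..n}" for i j
  proof -
    have "(i, i) \<notin> parcs G" "\<not> ((i, j) \<in> parcs G \<and> (j, i) \<in> parcs G)"
      using oriented[of i i] oriented[of i j] oriented[of j i] by auto
    then show ?thesis using that by (auto simp: Lap_def)
  qed
  have "{j \<in> {1..n}. (i, j) \<in> parcs G} = {j. (i, j) \<in> parcs G}"
    "{j \<in> {1..n}. (j, i) \<in> parcs G} = {j. (j, i) \<in> parcs G}" for i
    using arcs_subset by auto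
  then have restrict: "(\<Sum>j=1..n. if (i, j) \<in> parcs G then g i j else 0) = (\<Sum>j | (i, j) \<in> parcs G. g i j)"
    "(\<Sum>j=1..n. if (j, i) \<in> parcs G then g i j else 0) = (\<Sum>j | (j, i) \<in> parcs G. g i j)" for i
    by (simp_all only: flip: sum.inter_filter[OF finite_atLeastAtMost])
  have "(\<Sum>i=1..n. \<Sum>j=1..n. entry (Lap n G) i j * g i j) =
    (\<Sum>i=1..n. \<Sum>j=1..n. (if j = i then real (node_degree G i) * g i i else 0)
      - (if (i, j) \<in> parcs G then g i j else 0) - (if (j, i) \<in> parcs G then g i j else 0))"
    by (intro sum.cong refl entry_eq)
  also have "\<dots> = (\<Sum>i=1..n. real (node_degree G i) * g i i)
      - (\<Sum>i=1..n. \<Sum>j | (i, j) \<in> parcs G. g i j) - (\<Sum>i=1..n. \<Sum>j | (j, i) \<in> parcs G. g i j)"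
    unfolding sum_subtractf restrict by (auto intro!: sum.cong)
  also have "(\<Sum>i=1..n. \<Sum>j | (i, j) \<in> parcs G. g i j) = (\<Sum>(h, i)\<in>parcs G. g h i)"
    by (rule sum_out_arcs[OF _ arcs_subset]) simp
  also have "(\<Sum>i=1..n. \<Sum>j | (j, i) \<in> parcs G. g i j) = (\<Sum>(h, i)\<in>parcs G. g i h)"
    by (rule sum_in_arcs[OF _ arcs_subset, of "\<lambda>h i. g i h"]) simp
  also have "(\<Sum>i=1..n. real (node_degree G i) * g i i) = (\<Sum>(h, i)\<in>parcs G. g h h + g i i)"
    using sum_node_degree[OF _ arcs_subset, of "\<lambda>i. g i i"] by simp
  finally show ?thesis by (simp add: case_prod_unfold sum_subtractf)
qed

lemma entry_Lap:
  assumes "i \<in> {1..n}" "j \<in> {1..n}"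
  shows "entry (Lap n G) i j = (\<Sum>k=1..n-1. entry Z i k * entry Z j k)"
proof -
  have Z: "Z \<in> carrier_mat n (n - 1)" "Lap n G = Z * transpose_mat Z"
    using decomposition by (auto simp: onto_decomposition_def)
  have "entry (Lap n G) i j = (\<Sum>k=0..<n-1. Z $$ (i - 1, k) * Z $$ (j - 1, k))"
    unfolding Z(2) using Z(1) assms by (auto simp: scalar_prod_def)
  also have "\<dots> = (\<Sum>k=1..n-1. entry Z i k * entry Z j k)"
    by (rule sum.reindex_bij_witness[of _ "\<lambda>k. k - 1" Suc]) auto
  finally show ?thesis .
qed

lemma sum_norm_transpose:
  fixes x :: "nat \<Rightarrow> 'a::real_inner"
  shows "(\<Sum>k=1..n-1. (norm (\<Sum>i=1..n. entry Z i k *\<^sub>R x i))\<^sup>2) =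
    (\<Sum>(h, i)\<in>parcs G. (norm (x h - x i))\<^sup>2)"
proof -
  have "(\<Sum>k=1..n-1. (norm (\<Sum>i=1..n. entry Z i k *\<^sub>R x i))\<^sup>2) =
    (\<Sum>k=1..n-1. \<Sum>i=1..n. \<Sum>j=1..n. entry Z i k * entry Z j k * inner (x i) (x j))"
    by (simp add: power2_norm_eq_inner inner_sum_left inner_sum_right mult.assoc sum_distrib_left
        mult.left_commute inner_commute)
  also have "\<dots> = (\<Sum>i=1..n. \<Sum>k=1..n-1. \<Sum>j=1..n. entry Z i k * entry Z j k * inner (x i) (x j))"
    by (rule sum.swap)
  also have "\<dots> = (\<Sum>i=1..n. \<Sum>j=1..n. \<Sum>k=1..n-1. entry Z i k * entry Z j k * inner (x i) (x j))"
    by (intro sum.cong refl sum.swap)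
  also have "\<dots> = (\<Sum>i=1..n. \<Sum>j=1..n. entry (Lap n G) i j * inner (x i) (x j))"
    by (intro sum.cong refl) (simp only: entry_Lap sum_distrib_right)
  also have "\<dots> = (\<Sum>(h, i)\<in>parcs G. (norm (x h - x i))\<^sup>2)"
    unfolding sum_Lap
    by (intro sum.cong refl)
      (auto simp: power2_norm_eq_inner inner_diff_left inner_diff_right inner_commute)
  finally show ?thesis .
qed

text \<open>The all-ones vector has no differences along arcs, so the Laplacian form vanishes on it
  and the transpose of \<open>Z\<close> annihilates it.\<close>

lemma sum_column:
  assumes "k \<in> {1..n-1}"
  shows "(\<Sum>i=1..n. entry Z i k) = 0"
proof -
  have "(\<Sum>k=1..n-1. (norm (\<Sum>i=1..n. entry Z i k *\<^sub>R (1::real)))\<^sup>2) = 0"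
    unfolding sum_norm_transpose by simp
  then show ?thesis using assms by (subst (asm) sum_nonneg_eq_0_iff) auto
qed

lemma sum_mat_mult:
  fixes w :: "nat \<Rightarrow> 'a::real_vector"
  shows "(\<Sum>i=1..n. \<Sum>k=1..n-1. entry Z i k *\<^sub>R w k) = 0"
proof -
  have "(\<Sum>i=1..n. \<Sum>k=1..n-1. entry Z i k *\<^sub>R w k) = (\<Sum>k=1..n-1. (\<Sum>i=1..n. entry Z i k) *\<^sub>R w k)"
    unfolding scaleR_sum_left by (rule sum.swap)
  also have "\<dots> = (\<Sum>k=1..n-1. 0)"
    by (intro sum.cong refl) (simp only: sum_column scaleR_zero_left)
  finally show ?thesis by simp
qed

text \<open>Solve \<open>M y = v\<close>, where \<open>M\<close> is the Laplacian plus the all-ones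
  matrix. As \<open>v\<close> and the range of \<open>Z\<close> have zero sum, so does
  \<open>y\<close>; hence the Laplacian alone maps \<open>y\<close> to \<open>v\<close>, and
  \<open>w\<close> is the transpose of \<open>Z\<close> applied to \<open>y\<close>.\<close>

lemma range_decomposition:
  fixes v :: "nat \<Rightarrow> 'a::real_vector"
  assumes n: "n > 0" and v: "(\<Sum>i=1..n. v i) = 0"
  shows "\<exists>w. \<forall>i\<in>{1..n}. (\<Sum>k=1..n-1. entry Z i k *\<^sub>R w k) = v i"
proof -
  \<comment> \<open>Adding the all-ones matrix makes the Laplacian of a connected graph invertible.\<close>
  define M where "M = mat n n (\<lambda>(i, j). Lap n G $$ (i, j) + 1)"
  have M: "M \<in> carrier_mat n n" by (simp add: M_def)
  have entry_M: "entry M i j = entry (Lap n G) i j + 1" if "i \<in> {1..n}" "j \<in> {1..n}" for i j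
    using that by (auto simp: M_def)
  have mult_index: "(A * C) $$ (i - 1, j - 1) = (\<Sum>k=1..n. entry A i k * entry C k j)"
    if "A \<in> carrier_mat n n" "C \<in> carrier_mat n n" "i \<in> {1..n}" "j \<in> {1..n}"
    for A C :: "real mat" and i j
  proof -
    have "(A * C) $$ (i - 1, j - 1) = (\<Sum>k=0..<n. A $$ (i - 1, k) * C $$ (k, j - 1))"
      using that by (auto simp: scalar_prod_def)
    also have "\<dots> = (\<Sum>k=1..n. entry A i k * entry C k j)"
      by (rule sum.reindex_bij_witness[of _ "\<lambda>k. k - 1" Suc]) auto
    finally show ?thesis .
  qed
  have "det M \<noteq> 0"
  proof
    assume "det M = 0"
    then obtain u where u: "u \<in> carrier_vec n" "u \<noteq> 0\<^sub>v n" "M *\<^sub>v u = 0\<^sub>v n"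
      using det_0_iff_vec_prod_zero[OF M] by blast
    define x where "x = (\<lambda>i. u $ (i - 1))"
    have row: "(\<Sum>j=1..n. (entry (Lap n G) i j + 1) * x j) = 0" if i: "i \<in> {1..n}" for i
    proof -
      have "(\<Sum>j=1..n. (entry (Lap n G) i j + 1) * x j) = (\<Sum>j=1..n. entry M i j * x j)"
        using i by (intro sum.cong refl) (simp only: entry_M)
      also have "\<dots> = (\<Sum>j=0..<n. M $$ (i - 1, j) * u $ j)"
        unfolding x_def by (rule sum.reindex_bij_witness[of _ Suc "\<lambda>k. k - 1"]) auto
      also have "\<dots> = (M *\<^sub>v u) $ (i - 1)"
        using i u(1) M by (auto simp: scalar_prod_def)
      also have "\<dots> = 0" using i by (auto simp: u(3))
      finally show ?thesis .
    qed
    \<comment> \<open>The quadratic form of \<open>M\<close> is the sum of squared arc differences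
      plus the squared total. Where it vanishes, connectedness makes \<open>x\<close> constant and
      the total makes the constant zero.\<close>
    have "0 = (\<Sum>i=1..n. x i * (\<Sum>j=1..n. (entry (Lap n G) i j + 1) * x j))"
      using row by simp
    also have "\<dots> = (\<Sum>i=1..n. \<Sum>j=1..n. entry (Lap n G) i j * (x i * x j)) + (\<Sum>i=1..n. \<Sum>j=1..n. x i * x j)"
      by (simp add: sum_distrib_left sum.distrib algebra_simps)
    also have "(\<Sum>i=1..n. \<Sum>j=1..n. x i * x j) = (\<Sum>i=1..n. x i)\<^sup>2"
      by (simp add: power2_eq_square sum_product)
    also have "(\<Sum>i=1..n. \<Sum>j=1..n. entry (Lap n G) i j * (x i * x j)) = (\<Sum>(h, i)\<in>parcs G. (x h - x i)\<^sup>2)"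
      unfolding sum_Lap by (intro sum.cong refl) (auto simp: power2_eq_square algebra_simps)
    finally have eq: "(\<Sum>(h, i)\<in>parcs G. (x h - x i)\<^sup>2) + (\<Sum>i=1..n. x i)\<^sup>2 = 0" by simp
    have nonneg: "0 \<le> (\<Sum>(h, i)\<in>parcs G. (x h - x i)\<^sup>2)" by (intro sum_nonneg) auto
    then have sum0: "(\<Sum>i=1..n. x i) = 0"
      using eq add_nonneg_eq_0_iff[OF nonneg zero_le_power2, of "\<Sum>i=1..n. x i"] by simp
    have "(\<Sum>(h, i)\<in>parcs G. (x h - x i)\<^sup>2) = 0" using eq sum0 by simp
    then have "\<forall>e\<in>parcs G. (case e of (h, i) \<Rightarrow> (x h - x i)\<^sup>2) = 0"
      by (subst (asm) sum_nonneg_eq_0_iff) (auto simp: finite_arcs)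
    then have arc: "x h = x i" if "(h, i) \<in> parcs G" for h i using that by fastforce
    have const: "x i = x 1" if "i \<in> {1..n}" for i
    proof (rule connected_arc_induct[where G = G and R = "\<lambda>a b. x a = x b"])
    qed (use connected arc that n digraph in \<open>auto simp: digraph_on_def\<close>)
    have "(\<Sum>i=1..n. x i) = (\<Sum>i=1..n. x 1)" by (rule sum.cong[OF refl const])
    then have "(\<Sum>i=1..n. x i) = n * x 1" by simp
    then have "x 1 = 0" using sum0 n by simp
    then have "u $ j = 0" if "j < n" for j
      using const[of "Suc j"] that by (simp add: x_def)
    then show False using u(1,2) by auto
  qed
  \<comment> \<open>The adjugate over \<open>det M\<close> inverts \<open>M\<close>; it is applied
    through sums of entries because \<open>v\<close> takes values in a vector space.\<close>
  define N where "N = adj_mat M"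
  define y where "y = (\<lambda>j. (1 / det M) *\<^sub>R (\<Sum>k=1..n. entry N j k *\<^sub>R v k))"
  have inv: "(\<Sum>j=1..n. (entry (Lap n G) i j + 1) *\<^sub>R y j) = v i" if i: "i \<in> {1..n}" for i
  proof -
    have "(\<Sum>j=1..n. (entry (Lap n G) i j + 1) *\<^sub>R y j) = (\<Sum>j=1..n. entry M i j *\<^sub>R y j)"
      using i by (intro sum.cong refl) (simp only: entry_M)
    also have "\<dots> = (1 / det M) *\<^sub>R (\<Sum>j=1..n. \<Sum>k=1..n. (entry M i j * entry N j k) *\<^sub>R v k)"
      by (simp add: y_def scaleR_sum_right mult.commute mult.left_commute)
    also have "(\<Sum>j=1..n. \<Sum>k=1..n. (entry M i j * entry N j k) *\<^sub>R v k) =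
        (\<Sum>k=1..n. (\<Sum>j=1..n. entry M i j * entry N j k) *\<^sub>R v k)"
      unfolding scaleR_sum_left by (rule sum.swap)
    also have "\<dots> = (\<Sum>k=1..n. (if k = i then det M else 0) *\<^sub>R v k)"
    proof (intro sum.cong refl)
      fix k assume k: "k \<in> {1..n}"
      have "(\<Sum>j=1..n. entry M i j * entry N j k) = (M * N) $$ (i - 1, k - 1)"
        using adj_mat(1)[OF M] i k M by (subst mult_index) (auto simp: N_def)
      also have "\<dots> = (if k = i then det M else 0)"
        using adj_mat(2)[OF M] i k by (auto simp: N_def)
      finally show "(\<Sum>j=1..n. entry M i j * entry N j k) *\<^sub>R v k = (if k = i then det M else 0) *\<^sub>R v k"
        by simp
    qed
    also have "\<dots> = det M *\<^sub>R v i"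
      using i by (simp add: if_distrib[of "\<lambda>c. c *\<^sub>R _"] cong: if_cong)
    finally show ?thesis using \<open>det M \<noteq> 0\<close> by simp
  qed
  have Lap_y: "(\<Sum>j=1..n. entry (Lap n G) i j *\<^sub>R y j) =
      (\<Sum>k=1..n-1. entry Z i k *\<^sub>R (\<Sum>j=1..n. entry Z j k *\<^sub>R y j))" if i: "i \<in> {1..n}" for i
  proof -
    have "(\<Sum>j=1..n. entry (Lap n G) i j *\<^sub>R y j) =
        (\<Sum>j=1..n. \<Sum>k=1..n-1. (entry Z i k * entry Z j k) *\<^sub>R y j)"
      using i by (intro sum.cong refl) (simp only: entry_Lap scaleR_sum_left)
    also have "\<dots> = (\<Sum>k=1..n-1. \<Sum>j=1..n. (entry Z i k * entry Z j k) *\<^sub>R y j)"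
      by (rule sum.swap)
    finally show ?thesis by (simp add: scaleR_sum_right)
  qed
  have inv': "(\<Sum>k=1..n-1. entry Z i k *\<^sub>R (\<Sum>j=1..n. entry Z j k *\<^sub>R y j)) + (\<Sum>j=1..n. y j) = v i"
    if "i \<in> {1..n}" for i
    using inv[OF that] Lap_y[OF that] by (simp add: scaleR_add_left sum.distrib)
  have "(\<Sum>i=1..n. (\<Sum>k=1..n-1. entry Z i k *\<^sub>R (\<Sum>j=1..n. entry Z j k *\<^sub>R y j)) + (\<Sum>j=1..n. y j)) = 0"
    using inv' v by simp
  then have "real n *\<^sub>R (\<Sum>j=1..n. y j) = 0"
    using sum_mat_mult[of "\<lambda>k. \<Sum>j=1..n. entry Z j k *\<^sub>R y j"]
    by (simp only: sum.distrib sum_constant_scaleR card_atLeastAtMost) simp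
  then have "(\<Sum>j=1..n. y j) = 0" using n by simp
  then have "(\<Sum>k=1..n-1. entry Z i k *\<^sub>R (\<Sum>j=1..n. entry Z j k *\<^sub>R y j)) = v i"
    if "i \<in> {1..n}" for i
    using inv'[OF that] by (simp only: add_0_right)
  then show ?thesis
    by (intro exI[of _ "\<lambda>k. \<Sum>j=1..n. entry Z j k *\<^sub>R y j"] ballI)
qed

end

section \<open>One step of the algorithm\<close>

text \<open>\<open>C i\<close> is the cocoercive operator used at node \<open>i\<close>, evaluated at the iterate of node \<open>q i\<close>, so
  \<open>C i = B (i - 1)\<close> and \<open>q i = p i\<close> for \<open>i \<ge> 2\<close>. The first node has no such operator: there \<open>C\<close> is
  zero and \<open>q 1 = 1\<close>.\<close>

locale graph_splitting = laplacian_decomposition n G' Z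
  for n :: nat and G' :: "nat pair_pre_digraph" and Z :: "real mat" +
  fixes G :: "nat pair_pre_digraph" and q :: "nat \<Rightarrow> nat" and \<beta> \<gamma> :: real
    and A :: "nat \<Rightarrow> 'a::{real_inner, complete_space} operator" and C :: "nat \<Rightarrow> 'a \<Rightarrow> 'a"
  assumes algorithmic: "algorithmic_graph n G" and subgraph: "parcs G' \<subseteq> parcs G"
    and A: "\<And>i. i \<in> {1..n} \<Longrightarrow> maximally_monotone (A i)"
    and C: "\<And>i. i \<in> {1..n} \<Longrightarrow> cocoercive \<beta> (C i)"
    and q: "\<And>i. i \<in> {1..n} \<Longrightarrow> q i = i \<or> (q i, i) \<in> parcs G"
    and beta: "0 < \<beta>" and gamma: "0 < \<gamma>" "\<gamma> < 4 * \<beta>"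
begin

lemma arcs_G: "parcs G \<subseteq> {1..n} \<times> {1..n}"
  using algorithmic digraph_on_arcs by (simp add: algorithmic_graph_def)

lemma finite_arcs_G: "finite (parcs G)"
  using arcs_G finite_subset by blast

lemma n_ge_2: "2 \<le> n"
  using algorithmic by (simp add: algorithmic_graph_def)

lemma one_in_nodes: "1 \<in> {1..n}"
  using n_ge_2 by simp

lemma no_arc_to_first: "(h, 1) \<notin> parcs G"
  using algorithmic arcs_G unfolding algorithmic_graph_def by fastforce

lemma q_in: "i \<in> {1..n} \<Longrightarrow> q i \<in> {1..n}"
  using q arcs_G by fastforce

text \<open>Multiplication by \<open>Z\<close>; \<open>residual\<close> below is multiplication by
  its transpose and gives the direction in which \<open>w\<close> is updated.\<close>

definition lift :: "(nat \<Rightarrow> 'a) \<Rightarrow> nat \<Rightarrow> 'a" where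
  "lift w i = (\<Sum>k=1..n-1. entry Z i k *\<^sub>R w k)"

definition residual :: "(nat \<Rightarrow> 'a) \<Rightarrow> nat \<Rightarrow> 'a" where
  "residual x k = (\<Sum>i=1..n. entry Z i k *\<^sub>R x i)"

text \<open>The part linear in \<open>x\<close> of a node's resolvent equation after multiplication
  by the degree.\<close>

definition flow :: "(nat \<Rightarrow> 'a) \<Rightarrow> nat \<Rightarrow> 'a" where
  "flow x i = 2 *\<^sub>R (\<Sum>h | (h, i) \<in> parcs G. x h) - real (node_degree G i) *\<^sub>R x i"

text \<open>One sweep, with each resolvent replaced by its defining inclusion; \<open>a i\<close> is
  the element of \<open>A i (x i)\<close> that the resolvent selects.\<close>

definition state :: "(nat \<Rightarrow> 'a) \<Rightarrow> (nat \<Rightarrow> 'a) \<Rightarrow> (nat \<Rightarrow> 'a) \<Rightarrow> bool" where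
  "state w x a \<longleftrightarrow> (\<forall>i\<in>{1..n}. a i \<in> A i (x i) \<and>
    \<gamma> *\<^sub>R a i = flow x i - \<gamma> *\<^sub>R C i (x (q i)) + lift w i)"

text \<open>Sweeps on which all nodes agree. Their residual is zero, so the update leaves such
  \<open>w\<close> fixed.\<close>

definition solution :: "(nat \<Rightarrow> 'a) \<Rightarrow> 'a \<Rightarrow> bool" where
  "solution w x \<longleftrightarrow> (\<exists>a. state w (\<lambda>_. x) a)"

section \<open>Summation identities over nodes and arcs\<close>

lemma lift_diff: "lift (\<lambda>k. w k - w' k) i = lift w i - lift w' i"
  by (simp add: lift_def scaleR_diff_right sum_subtractf)

lemma residual_diff: "residual (\<lambda>i. x i - x' i) k = residual x k - residual x' k"
  by (simp add: residual_def scaleR_diff_right sum_subtractf)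

lemma flow_diff: "flow (\<lambda>i. x i - x' i) i = flow x i - flow x' i"
  by (simp add: flow_def scaleR_diff_right sum_subtractf)

lemma sum_lift: "(\<Sum>i=1..n. lift w i) = 0"
  unfolding lift_def by (rule sum_mat_mult)

lemma residual_const: "k \<in> {1..n-1} \<Longrightarrow> residual (\<lambda>_. x) k = 0"
  unfolding residual_def by (simp only: flip: scaleR_sum_left) (simp only: sum_column scaleR_zero_left)

lemma sum_norm_residual:
  "(\<Sum>k=1..n-1. (norm (residual x k))\<^sup>2) = (\<Sum>(h, i)\<in>parcs G'. (norm (x h - x i))\<^sup>2)"
  unfolding residual_def by (rule sum_norm_transpose)

lemma sum_inner_lift: "(\<Sum>i=1..n. inner (lift w i) (x i)) = (\<Sum>k=1..n-1. inner (w k) (residual x k))"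
proof -
  have "(\<Sum>i=1..n. inner (lift w i) (x i)) = (\<Sum>i=1..n. \<Sum>k=1..n-1. entry Z i k * inner (w k) (x i))"
    by (simp add: lift_def inner_sum_left)
  also have "\<dots> = (\<Sum>k=1..n-1. \<Sum>i=1..n. entry Z i k * inner (w k) (x i))"
    by (rule sum.swap)
  finally show ?thesis by (simp add: residual_def inner_sum_right)
qed

lemma sum_flow: "(\<Sum>i=1..n. flow x i) = (\<Sum>(h, i)\<in>parcs G. x h - x i)"
proof -
  have "(\<Sum>i=1..n. flow x i) =
      2 *\<^sub>R (\<Sum>i=1..n. \<Sum>h | (h, i) \<in> parcs G. x h) - (\<Sum>i=1..n. real (node_degree G i) *\<^sub>R x i)"
    by (simp add: flow_def sum_subtractf scaleR_sum_right)
  also have "\<dots> = 2 *\<^sub>R (\<Sum>(h, i)\<in>parcs G. x h) - (\<Sum>(h, i)\<in>parcs G. x h + x i)"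
    using sum_in_arcs[OF _ arcs_G, of "\<lambda>h i. x h"] sum_node_degree[OF _ arcs_G, of x] by simp
  also have "\<dots> = (\<Sum>(h, i)\<in>parcs G. x h - x i)"
    by (simp add: case_prod_unfold scaleR_sum_right flip: sum_subtractf)
      (simp add: scaleR_2)
  finally show ?thesis .
qed

lemma sum_inner_flow:
  "(\<Sum>i=1..n. inner (flow x i) (x i)) = - (\<Sum>(h, i)\<in>parcs G. (norm (x h - x i))\<^sup>2)"
proof -
  have "(\<Sum>i=1..n. inner (flow x i) (x i)) =
      2 * (\<Sum>i=1..n. \<Sum>h | (h, i) \<in> parcs G. inner (x h) (x i))
      - (\<Sum>i=1..n. real (node_degree G i) *\<^sub>R inner (x i) (x i))"
    by (simp add: flow_def inner_diff_left inner_sum_left sum_subtractf sum_distrib_left)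
  also have "\<dots> = 2 * (\<Sum>(h, i)\<in>parcs G. inner (x h) (x i))
      - (\<Sum>(h, i)\<in>parcs G. inner (x h) (x h) + inner (x i) (x i))"
    using sum_in_arcs[OF _ arcs_G, of "\<lambda>h i. inner (x h) (x i)"]
      sum_node_degree[OF _ arcs_G, of "\<lambda>i. inner (x i) (x i)"] by simp
  also have "\<dots> = (\<Sum>(h, i)\<in>parcs G. - (norm (x h - x i))\<^sup>2)"
    unfolding sum_distrib_left sum_subtractf[symmetric]
    by (intro sum.cong refl)
      (auto simp: power2_norm_eq_inner inner_diff_left inner_diff_right inner_commute)
  finally show ?thesis by (simp add: case_prod_unfold sum_negf)
qed

text \<open>Distinct nodes use distinct arcs \<open>(q i, i)\<close>, and nodes with
  \<open>q i = i\<close> contribute nothing.\<close>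

lemma sum_predecessor_le:
  "(\<Sum>i=1..n. (norm (x (q i) - x i))\<^sup>2) \<le> (\<Sum>(h, i)\<in>parcs G. (norm (x h - x i))\<^sup>2)"
proof -
  define I where "I = {i \<in> {1..n}. q i \<noteq> i}"
  have "(\<Sum>i=1..n. (norm (x (q i) - x i))\<^sup>2) = (\<Sum>i\<in>I. (norm (x (q i) - x i))\<^sup>2)"
    unfolding I_def by (intro sum.mono_neutral_right) auto
  also have "\<dots> = (\<Sum>(h, i)\<in>(\<lambda>i. (q i, i)) ` I. (norm (x h - x i))\<^sup>2)"
    by (subst sum.reindex) (auto simp: inj_on_def)
  also have "\<dots> \<le> (\<Sum>(h, i)\<in>parcs G. (norm (x h - x i))\<^sup>2)"
    using q by (intro sum_mono2 finite_arcs_G) (auto simp: I_def)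
  finally show ?thesis .
qed

text \<open>The cocoercivity of \<open>C i\<close> absorbs the mismatch between the point where \<open>C i\<close> is evaluated
  and the point where it is tested: this is Young's inequality, and the source of the
  bound \<open>\<gamma> < 4 * \<beta>\<close>.\<close>

lemma cocoercive_shifted:
  assumes "cocoercive \<beta> B"
  shows "- inner (B y - B y') d \<le> (norm (y - y' - d))\<^sup>2 / (4 * \<beta>)"
proof -
  define D where "D = B y - B y'"
  define e where "e = y - y' - d"
  have "\<beta> * inner D D \<le> inner D (y - y')"
    using assms by (simp add: cocoercive_def D_def power2_norm_eq_inner)
  \<comment> \<open>The weight is chosen so that, after multiplication by \<open>\<beta>\<close>,
    the cross term is exactly \<open>inner D e\<close>.\<close>
  moreover have "0 \<le> inner (D - (1 / (2 * \<beta>)) *\<^sub>R e) (D - (1 / (2 * \<beta>)) *\<^sub>R e)"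
    by (rule inner_ge_zero)
  then have "0 \<le> \<beta> * (inner D D - inner D e / \<beta> + inner e e / (4 * \<beta>\<^sup>2))"
    using beta by (simp add: inner_diff_left inner_diff_right inner_commute power2_eq_square)
  then have "0 \<le> \<beta> * inner D D - inner D e + inner e e / (4 * \<beta>)"
    using beta by (simp add: distrib_left right_diff_distrib power2_eq_square)
  moreover have "inner D (y - y') = inner D e + inner D d"
    by (simp add: e_def inner_diff_right)
  ultimately have "- inner D d \<le> inner e e / (4 * \<beta>)" by linarith
  then show ?thesis by (simp add: D_def e_def power2_norm_eq_inner)
qed

text \<open>Sum the monotonicity inequalities over the nodes. The flow contributes minus the energy
  \<open>e\<close> of the arcs of \<open>G\<close>, the operators \<open>C i\<close> at most
  \<open>\<gamma> / (4 * \<beta>) * e\<close>, and \<open>lift\<close> the inner product on the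
  right. The squared residual is the energy of the arcs of \<open>G'\<close>, a part of
  \<open>e\<close>.\<close>

lemma residual_cocoercive:
  assumes s: "state w x a" and s': "state w' x' a'"
  shows "(4 * \<beta> - \<gamma>) / (4 * \<beta>) * (\<Sum>k=1..n-1. (norm (residual x k - residual x' k))\<^sup>2)
    \<le> (\<Sum>k=1..n-1. inner (w k - w' k) (residual x k - residual x' k))"
proof -
  define y where "y = (\<lambda>i. x i - x' i)"
  define c where "c = (\<lambda>i. C i (x (q i)) - C i (x' (q i)))"
  define e where "e = (\<Sum>(h, i)\<in>parcs G. (norm (y h - y i))\<^sup>2)"
  have "0 \<le> inner (\<gamma> *\<^sub>R a i - \<gamma> *\<^sub>R a' i) (y i)" if "i \<in> {1..n}" for i
  proof -
    have "0 \<le> inner (a i - a' i) (x i - x' i)"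
      using A[OF that] s s' that op_monotoneD unfolding maximally_monotone_def state_def by blast
    then show ?thesis using gamma(1) by (simp add: y_def flip: scaleR_right_diff_distrib)
  qed
  then have "0 \<le> (\<Sum>i=1..n. inner (\<gamma> *\<^sub>R a i - \<gamma> *\<^sub>R a' i) (y i))"
    by (rule sum_nonneg)
  also have "\<dots> = (\<Sum>i=1..n. inner (flow y i) (y i) + \<gamma> * - inner (c i) (y i)
      + inner (lift (\<lambda>k. w k - w' k) i) (y i))"
  proof (intro sum.cong refl)
    fix i assume i: "i \<in> {1..n}"
    have "\<gamma> *\<^sub>R a i - \<gamma> *\<^sub>R a' i = flow y i - \<gamma> *\<^sub>R c i + lift (\<lambda>k. w k - w' k) i"
      using s s' i by (simp add: state_def y_def c_def flow_diff lift_diff algebra_simps)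
    then show "inner (\<gamma> *\<^sub>R a i - \<gamma> *\<^sub>R a' i) (y i) = inner (flow y i) (y i)
        + \<gamma> * - inner (c i) (y i) + inner (lift (\<lambda>k. w k - w' k) i) (y i)"
      by (simp add: inner_add_left inner_diff_left)
  qed
  also have "\<dots> = - e + \<gamma> * (\<Sum>i=1..n. - inner (c i) (y i))
      + (\<Sum>k=1..n-1. inner (w k - w' k) (residual y k))"
    by (simp only: sum.distrib sum_inner_flow sum_inner_lift e_def sum_distrib_left)
  finally have main: "e - \<gamma> * (\<Sum>i=1..n. - inner (c i) (y i))
      \<le> (\<Sum>k=1..n-1. inner (w k - w' k) (residual y k))" by simp
  have "(\<Sum>i=1..n. - inner (c i) (y i)) \<le> (\<Sum>i=1..n. (norm (y (q i) - y i))\<^sup>2 / (4 * \<beta>))"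
    unfolding c_def y_def by (intro sum_mono cocoercive_shifted C)
  also have "\<dots> \<le> e / (4 * \<beta>)"
    using sum_predecessor_le[of y] beta
    by (simp add: e_def divide_right_mono flip: sum_divide_distrib)
  finally have "\<gamma> * (\<Sum>i=1..n. - inner (c i) (y i)) \<le> \<gamma> * (e / (4 * \<beta>))"
    using gamma(1) by (intro mult_left_mono) auto
  then have "(4 * \<beta> - \<gamma>) / (4 * \<beta>) * e \<le> e - \<gamma> * (\<Sum>i=1..n. - inner (c i) (y i))"
    using beta by (simp add: field_simps)
  moreover have "(\<Sum>k=1..n-1. (norm (residual y k))\<^sup>2) \<le> e"
    unfolding sum_norm_residual e_def using subgraph by (intro sum_mono2 finite_arcs_G) auto
  then have "(4 * \<beta> - \<gamma>) / (4 * \<beta>) * (\<Sum>k=1..n-1. (norm (residual y k))\<^sup>2)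
      \<le> (4 * \<beta> - \<gamma>) / (4 * \<beta>) * e"
    using beta gamma by (intro mult_left_mono) auto
  ultimately show ?thesis using main by (simp add: y_def residual_diff)
qed

lemma flow_first: "flow x 1 = - (real (node_degree G 1) *\<^sub>R x 1)"
  using no_arc_to_first by (simp add: flow_def)

lemma q_first: "q 1 = 1"
  using q[OF one_in_nodes] no_arc_to_first by blast

text \<open>Node \<open>1\<close> has no predecessors, so its value depends on \<open>w\<close>
  alone, and monotonicity makes this dependence Lipschitz. Boundedness of the iterates and
  uniqueness of the limit point rest on it.\<close>

lemma first_node_lipschitz:
  assumes s: "state w x a" and s': "state w' x' a'"
  shows "real (node_degree G 1) * norm (x 1 - x' 1) \<le> norm (lift w 1 - lift w' 1)"
proof (cases "x 1 = x' 1")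
  case False
  let ?d = "real (node_degree G 1)" and ?y = "x 1 - x' 1"
  have "0 \<le> inner (a 1 - a' 1) ?y"
    using A[OF one_in_nodes] s s' one_in_nodes op_monotoneD
    unfolding maximally_monotone_def state_def by blast
  then have "0 \<le> inner (\<gamma> *\<^sub>R a 1 - \<gamma> *\<^sub>R a' 1) ?y"
    using gamma(1) by (simp flip: scaleR_right_diff_distrib)
  also have "\<gamma> *\<^sub>R a 1 - \<gamma> *\<^sub>R a' 1 =
      (lift w 1 - lift w' 1) - ?d *\<^sub>R ?y - \<gamma> *\<^sub>R (C 1 (x 1) - C 1 (x' 1))"
  proof -
    have eq: "\<gamma> *\<^sub>R a 1 = flow x 1 - \<gamma> *\<^sub>R C 1 (x 1) + lift w 1"
      "\<gamma> *\<^sub>R a' 1 = flow x' 1 - \<gamma> *\<^sub>R C 1 (x' 1) + lift w' 1"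
      using s s' one_in_nodes q_first unfolding state_def by metis+
    show ?thesis unfolding eq flow_first by (simp add: scaleR_diff_right)
  qed
  also have "inner \<dots> ?y = inner (lift w 1 - lift w' 1) ?y - ?d * inner ?y ?y
      - \<gamma> * inner (C 1 (x 1) - C 1 (x' 1)) ?y"
    by (simp only: inner_diff_left[of "lift w 1 - lift w' 1"] inner_diff_left[of "lift w 1 - lift w' 1 - _"]
        inner_scaleR_left)
  finally have "?d * inner ?y ?y + \<gamma> * inner (C 1 (x 1) - C 1 (x' 1)) ?y
      \<le> inner (lift w 1 - lift w' 1) ?y"
    by linarith
  moreover have "0 \<le> \<beta> * (norm (C 1 (x 1) - C 1 (x' 1)))\<^sup>2" using beta by simp
  then have "0 \<le> inner (C 1 (x 1) - C 1 (x' 1)) ?y"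
    using C[OF one_in_nodes] unfolding cocoercive_def by (blast intro: order_trans)
  then have "0 \<le> \<gamma> * inner (C 1 (x 1) - C 1 (x' 1)) ?y" using gamma(1) by simp
  moreover have "inner (lift w 1 - lift w' 1) ?y \<le> norm (lift w 1 - lift w' 1) * norm ?y"
    by (rule norm_cauchy_schwarz)
  ultimately have "?d * inner ?y ?y \<le> norm (lift w 1 - lift w' 1) * norm ?y" by linarith
  then have "norm ?y * (?d * norm ?y) \<le> norm ?y * norm (lift w 1 - lift w' 1)"
    unfolding power2_norm_eq_inner[symmetric]
    by (simp add: power2_eq_square mult.commute mult.left_commute)
  then show ?thesis using False by simp
qed simp

lemma degree_pos: "i \<in> {1..n} \<Longrightarrow> 0 < real (node_degree G i)"
  using node_degree_pos[OF algorithmic] by simp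

text \<open>Summed over the nodes, the lifts cancel and the flow reduces to arc differences. With
  \<open>c\<close> left free this applies to values of the \<open>C i\<close> and to their weak
  limits.\<close>

lemma balance:
  assumes "\<And>i. i \<in> {1..n} \<Longrightarrow> \<gamma> *\<^sub>R a i = flow x i - \<gamma> *\<^sub>R c i + lift w i"
  shows "\<gamma> *\<^sub>R ((\<Sum>i=1..n. a i) + (\<Sum>i=1..n. c i)) = (\<Sum>(h, i)\<in>parcs G. x h - x i)"
proof -
  have "\<gamma> *\<^sub>R ((\<Sum>i=1..n. a i) + (\<Sum>i=1..n. c i)) = (\<Sum>i=1..n. \<gamma> *\<^sub>R a i + \<gamma> *\<^sub>R c i)"
    by (simp add: scaleR_add_right scaleR_sum_right sum.distrib)
  also have "\<dots> = (\<Sum>i=1..n. flow x i + lift w i)"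
    using assms by (intro sum.cong) auto
  finally show ?thesis by (simp only: sum.distrib sum_flow sum_lift add_0_right)
qed

lemma solution_imp_zero:
  assumes "solution w x"
  shows "\<exists>a. (\<forall>i\<in>{1..n}. a i \<in> A i x) \<and> (\<Sum>i=1..n. a i) + (\<Sum>i=1..n. C i x) = 0"
proof -
  obtain a where a: "state w (\<lambda>_. x) a" using assms by (auto simp: solution_def)
  then have "\<gamma> *\<^sub>R ((\<Sum>i=1..n. a i) + (\<Sum>i=1..n. C i x)) = (\<Sum>(h, i)\<in>parcs G. x - x)"
    by (intro balance) (auto simp: state_def)
  then show ?thesis using a gamma(1) by (intro exI[of _ a]) (simp add: state_def case_prod_unfold)
qed

lemma zero_imp_solution:
  assumes a: "\<And>i. i \<in> {1..n} \<Longrightarrow> a i \<in> A i x"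
    and zero: "(\<Sum>i=1..n. a i) + (\<Sum>i=1..n. C i x) = 0"
  shows "\<exists>w. solution w x"
proof -
  \<comment> \<open>The value that \<open>lift w\<close> must take for the state equation; its total
    vanishes, so it lies in the range of \<open>Z\<close>.\<close>
  define v where "v = (\<lambda>i. \<gamma> *\<^sub>R (a i + C i x) - flow (\<lambda>_. x) i)"
  have "(\<Sum>i=1..n. v i) = \<gamma> *\<^sub>R ((\<Sum>i=1..n. a i) + (\<Sum>i=1..n. C i x)) - (\<Sum>i=1..n. flow (\<lambda>_. x) i)"
    by (simp only: v_def sum_subtractf sum.distrib scaleR_sum_right scaleR_add_right)
  also have "\<dots> = 0" unfolding zero sum_flow by (simp add: case_prod_unfold)
  finally have "(\<Sum>i=1..n. v i) = 0" .
  then obtain w where w: "\<forall>i\<in>{1..n}. (\<Sum>k=1..n-1. entry Z i k *\<^sub>R w k) = v i"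
    using range_decomposition[of v] n_ge_2 by fastforce
  have "state w (\<lambda>_. x) a"
    unfolding state_def
  proof (intro ballI conjI)
    fix i assume i: "i \<in> {1..n}"
    show "a i \<in> A i x" by (rule a[OF i])
    have "lift w i = v i" unfolding lift_def using w i by blast
    then show "\<gamma> *\<^sub>R a i = flow (\<lambda>_. x) i - \<gamma> *\<^sub>R C i x + lift w i"
      by (simp add: v_def scaleR_add_right)
  qed
  then show ?thesis by (auto simp: solution_def)
qed

end

section \<open>Convergence of the iteration\<close>

text \<open>As \<open>e\<close> decreases, its last value times the total weight is at most the
  weighted sum, hence at most \<open>S\<close>.\<close>

lemma tendsto_zero_of_weighted_sum:
  fixes e t :: "nat \<Rightarrow> real"
  assumes e: "\<And>k. 0 \<le> e k" "decseq e" and t: "\<And>k. 0 \<le> t k"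
    and bound: "\<And>N. (\<Sum>k<N. t k * e k) \<le> S"
    and diverges: "filterlim (\<lambda>N. \<Sum>k<N. t k) at_top sequentially"
  shows "e \<longlonglongrightarrow> 0"
proof (rule tendsto_sandwich)
  show "\<forall>\<^sub>F N in sequentially. 0 \<le> e N" using e(1) by simp
  show "\<forall>\<^sub>F N in sequentially. e N \<le> S / (\<Sum>k<N. t k)"
    using filterlim_at_top_dense[THEN iffD1, OF diverges, rule_format, of 0]
  proof eventually_elim
    case (elim N)
    have "e N * (\<Sum>k<N. t k) = (\<Sum>k<N. t k * e N)"
      by (simp add: sum_distrib_left mult.commute)
    also have "\<dots> \<le> (\<Sum>k<N. t k * e k)"
      using e(2) t by (intro sum_mono mult_left_mono) (auto simp: decseq_def)
    also have "\<dots> \<le> S" by (rule bound)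
    finally show ?case using elim by (simp add: field_simps)
  qed
  show "(\<lambda>N. S / (\<Sum>k<N. t k)) \<longlonglongrightarrow> 0"
    by (rule tendsto_divide_0[OF tendsto_const filterlim_at_top_imp_at_infinity[OF diverges]])
qed simp

lemma norm_diff_scaleR_squared:
  fixes u r :: "'a::real_inner"
  shows "(norm (u - t *\<^sub>R r))\<^sup>2 = (norm u)\<^sup>2 - 2 * t * inner u r + t\<^sup>2 * (norm r)\<^sup>2"
  unfolding power2_norm_eq_inner
  by (simp add: inner_diff_left inner_diff_right inner_commute power2_eq_square algebra_simps)

lemma bounded_range_sum:
  fixes u :: "'i \<Rightarrow> 'k \<Rightarrow> 'a::real_normed_vector"
  assumes "\<And>i. i \<in> I \<Longrightarrow> bounded (range (u i))"
  shows "bounded (range (\<lambda>k. \<Sum>i\<in>I. u i k))"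
proof (cases "finite I")
  case True
  then show ?thesis using assms
    by (induction I) (auto simp: image_constant_conv intro!: bounded_plus_comp)
qed (simp add: image_constant_conv)

lemma bounded_rangeE:
  assumes "bounded (range u)"
  obtains K where "\<And>k. norm (u k) \<le> K"
  using assms unfolding bounded_iff by auto

lemma bounded_rangeI: "(\<And>k. norm (u k) \<le> K) \<Longrightarrow> bounded (range u)"
  unfolding bounded_iff by auto

text \<open>Here \<open>x k\<close> is the sweep computed from \<open>w k\<close>, so the iterates
  of the theorem enter with index \<open>Suc k\<close>.\<close>

locale graph_splitting_iteration = graph_splitting n G' Z G q \<beta> \<gamma> A C
  for n G' Z G q \<beta> \<gamma> and A :: "nat \<Rightarrow> 'a::{real_inner, complete_space} operator" and C +
  fixes w x a :: "nat \<Rightarrow> nat \<Rightarrow> 'a" and \<theta> :: "nat \<Rightarrow> real"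
  assumes state: "\<And>k. state (w k) (x k) (a k)"
    and step: "\<And>k j. j \<in> {1..n-1} \<Longrightarrow> w (Suc k) j = w k j - \<theta> k *\<^sub>R residual (x k) j"
    and theta: "\<And>k. 0 < \<theta> k" "\<And>k. \<theta> k \<le> (4 * \<beta> - \<gamma>) / (2 * \<beta>)"
    and theta_sum: "filterlim (\<lambda>N. \<Sum>k<N. \<theta> k * ((4 * \<beta> - \<gamma>) / (2 * \<beta>) - \<theta> k)) at_top sequentially"
    and solvable: "\<exists>w\<^sub>0 x\<^sub>0. solution w\<^sub>0 x\<^sub>0"
begin

section \<open>Fejer monotonicity and decay of the residual\<close>

definition err :: "nat \<Rightarrow> real" where
  "err k = (\<Sum>j=1..n-1. (norm (residual (x k) j))\<^sup>2)"

definition dist2 :: "(nat \<Rightarrow> 'a) \<Rightarrow> nat \<Rightarrow> real" where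
  "dist2 w' k = (\<Sum>j=1..n-1. (norm (w k j - w' j))\<^sup>2)"

lemma cocoercive_half:
  assumes "state v y b" "state v' y' b'"
  shows "(4 * \<beta> - \<gamma>) / (2 * \<beta>) / 2 * (\<Sum>k=1..n-1. (norm (residual y k - residual y' k))\<^sup>2)
    \<le> (\<Sum>k=1..n-1. inner (v k - v' k) (residual y k - residual y' k))"
  using residual_cocoercive[OF assms] by simp

text \<open>Expand the square of the update; cocoercivity against the solution, whose residual is
  zero, bounds the cross term.\<close>

lemma fejer:
  assumes "solution w' x'"
  shows "dist2 w' (Suc k) + \<theta> k * ((4 * \<beta> - \<gamma>) / (2 * \<beta>) - \<theta> k) * err k \<le> dist2 w' k"
proof -
  let ?ip = "\<Sum>j=1..n-1. inner (w k j - w' j) (residual (x k) j)"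
  define \<kappa> where "\<kappa> = (4 * \<beta> - \<gamma>) / (2 * \<beta>)"
  obtain a' where a': "state w' (\<lambda>_. x') a'" using assms by (auto simp: solution_def)
  have "(\<Sum>j=1..n-1. (norm (residual (x k) j - residual (\<lambda>_. x') j))\<^sup>2) = err k"
    unfolding err_def by (intro sum.cong refl) (simp only: residual_const diff_zero)
  moreover have "(\<Sum>j=1..n-1. inner (w k j - w' j) (residual (x k) j - residual (\<lambda>_. x') j)) = ?ip"
    by (intro sum.cong refl) (simp only: residual_const diff_zero)
  ultimately have ip: "(4 * \<beta> - \<gamma>) / (2 * \<beta>) / 2 * err k \<le> ?ip"
    using cocoercive_half[OF state[of k] a'] by simp
  have "dist2 w' (Suc k) = (\<Sum>j=1..n-1. (norm (w k j - w' j))\<^sup>2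
      - 2 * \<theta> k * inner (w k j - w' j) (residual (x k) j) + (\<theta> k)\<^sup>2 * (norm (residual (x k) j))\<^sup>2)"
    unfolding dist2_def
  proof (intro sum.cong refl)
    fix j assume "j \<in> {1..n-1}"
    then have "w (Suc k) j - w' j = (w k j - w' j) - \<theta> k *\<^sub>R residual (x k) j"
      by (simp add: step)
    then show "(norm (w (Suc k) j - w' j))\<^sup>2 = (norm (w k j - w' j))\<^sup>2
      - 2 * \<theta> k * inner (w k j - w' j) (residual (x k) j) + (\<theta> k)\<^sup>2 * (norm (residual (x k) j))\<^sup>2"
      by (simp only: norm_diff_scaleR_squared)
  qed
  also have "\<dots> = dist2 w' k - 2 * \<theta> k * ?ip + (\<theta> k)\<^sup>2 * err k"
    by (simp add: dist2_def err_def sum.distrib sum_subtractf sum_distrib_left)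
  also have "\<dots> \<le> dist2 w' k - 2 * \<theta> k * (\<kappa> / 2 * err k) + (\<theta> k)\<^sup>2 * err k"
    using mult_left_mono[OF ip, of "2 * \<theta> k"] theta(1)[of k] unfolding \<kappa>_def by linarith
  finally show ?thesis
    unfolding \<kappa>_def[symmetric] by (simp add: algebra_simps power2_eq_square)
qed

lemma err_nonneg: "0 \<le> err k"
  unfolding err_def by (intro sum_nonneg) simp

text \<open>Fejer monotonicity bounds only a weighted sum of \<open>err\<close>; decrease turns this
  into convergence. It comes from cocoercivity between consecutive sweeps, whose \<open>w\<close>
  differ by \<open>- \<theta> k\<close> times the residual, as \<open>\<theta> k\<close> is at most
  twice the cocoercivity constant.\<close>

lemma decseq_err: "decseq err"
proof (rule decseq_SucI)
  fix k
  let ?r = "residual (x k)" and ?s = "residual (x (Suc k))"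
  let ?d = "\<Sum>j=1..n-1. (norm (?s j - ?r j))\<^sup>2"
  have "\<theta> k / 2 * ?d \<le> (4 * \<beta> - \<gamma>) / (2 * \<beta>) / 2 * ?d"
    using theta(2)[of k] by (intro mult_right_mono divide_right_mono) (auto intro: sum_nonneg)
  also have "\<dots> \<le> (\<Sum>j=1..n-1. inner (w (Suc k) j - w k j) (?s j - ?r j))"
    by (rule cocoercive_half[OF state state])
  also have "\<dots> = (\<Sum>j=1..n-1. \<theta> k * - inner (?r j) (?s j - ?r j))"
    by (intro sum.cong refl) (simp add: step)
  also have "\<dots> = \<theta> k * (\<Sum>j=1..n-1. - inner (?r j) (?s j - ?r j))"
    by (simp only: sum_distrib_left)
  finally have "?d \<le> 2 * (\<Sum>j=1..n-1. - inner (?r j) (?s j - ?r j))"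
    using theta(1)[of k] by simp
  moreover have "err (Suc k) = (\<Sum>j=1..n-1. (norm (?r j))\<^sup>2 - 2 * - inner (?r j) (?s j - ?r j)
      + (norm (?s j - ?r j))\<^sup>2)"
    unfolding err_def
    by (intro sum.cong refl)
      (simp add: power2_norm_eq_inner inner_diff_left inner_diff_right inner_commute)
  then have "err (Suc k) = err k - 2 * (\<Sum>j=1..n-1. - inner (?r j) (?s j - ?r j)) + ?d"
    by (simp only: err_def sum.distrib sum_subtractf sum_distrib_left)
  ultimately show "err (Suc k) \<le> err k" by linarith
qed

lemma weight_nonneg: "0 \<le> \<theta> k * ((4 * \<beta> - \<gamma>) / (2 * \<beta>) - \<theta> k)"
  using theta[of k] by simp

lemma dist2_nonneg: "0 \<le> dist2 w' k"
  unfolding dist2_def by (intro sum_nonneg) simp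

lemma decseq_dist2:
  assumes "solution w' x'"
  shows "decseq (dist2 w')"
proof (rule decseq_SucI)
  show "dist2 w' (Suc k) \<le> dist2 w' k" for k
    using fejer[OF assms, of k] mult_nonneg_nonneg[OF weight_nonneg err_nonneg, of k k] by linarith
qed

lemma err_tendsto_0: "err \<longlonglongrightarrow> 0"
proof -
  obtain w' x' where sol: "solution w' x'" using solvable by blast
  have sum_le: "(\<Sum>k<N. \<theta> k * ((4 * \<beta> - \<gamma>) / (2 * \<beta>) - \<theta> k) * err k) + dist2 w' N \<le> dist2 w' 0" for N
  proof (induction N)
    case (Suc N)
    then show ?case using fejer[OF sol, of N] by simp
  qed simp
  show ?thesis
  proof (rule tendsto_zero_of_weighted_sum[OF err_nonneg decseq_err weight_nonneg _ theta_sum])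
    show "(\<Sum>k<N. \<theta> k * ((4 * \<beta> - \<gamma>) / (2 * \<beta>) - \<theta> k) * err k) \<le> dist2 w' 0" for N
      using sum_le[of N] dist2_nonneg[of w' N] by linarith
  qed
qed

text \<open>\<open>err\<close> is the energy of the arcs of \<open>G'\<close>, so differences along
  these arcs vanish, and connectedness extends this to all pairs.\<close>

lemma node_difference_tendsto_0:
  assumes "h \<in> {1..n}" "i \<in> {1..n}"
  shows "(\<lambda>k. x k h - x k i) \<longlonglongrightarrow> 0"
proof (rule connected_arc_induct[where G = G' and R = "\<lambda>h i. (\<lambda>k. x k h - x k i) \<longlonglongrightarrow> 0"])
  fix h i assume arc: "(h, i) \<in> parcs G'"
  have "norm (x k h - x k i) \<le> sqrt (err k)" for k
  proof (rule real_le_rsqrt)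
    have "err k = (\<Sum>(h, i)\<in>parcs G'. (norm (x k h - x k i))\<^sup>2)"
      unfolding err_def by (rule sum_norm_residual)
    moreover have "(case (h, i) of (h, i) \<Rightarrow> (norm (x k h - x k i))\<^sup>2)
        \<le> (\<Sum>(h, i)\<in>parcs G'. (norm (x k h - x k i))\<^sup>2)"
      by (rule member_le_sum[OF arc _ finite_arcs]) auto
    ultimately show "(norm (x k h - x k i))\<^sup>2 \<le> err k" by simp
  qed
  moreover have "(\<lambda>k. sqrt (err k)) \<longlonglongrightarrow> 0"
    using tendsto_real_sqrt[OF err_tendsto_0] by simp
  ultimately show "(\<lambda>k. x k h - x k i) \<longlonglongrightarrow> 0"
    by (rule Lim_null_comparison[OF always_eventually, rule_format])
next
  fix a b assume "(\<lambda>k. x k a - x k b) \<longlonglongrightarrow> 0"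
  then show "(\<lambda>k. x k b - x k a) \<longlonglongrightarrow> 0"
    using tendsto_minus[of "\<lambda>k. x k a - x k b" 0] by simp
next
  fix a b c assume "(\<lambda>k. x k a - x k b) \<longlonglongrightarrow> 0" "(\<lambda>k. x k b - x k c) \<longlonglongrightarrow> 0"
  then show "(\<lambda>k. x k a - x k c) \<longlonglongrightarrow> 0"
    using tendsto_add[of "\<lambda>k. x k a - x k b" 0 sequentially "\<lambda>k. x k b - x k c" 0] by simp
qed (use connected digraph assms in \<open>simp_all add: digraph_on_def\<close>)

section \<open>Boundedness of the iterates\<close>

lemma bounded_w: "j \<in> {1..n-1} \<Longrightarrow> bounded (range (\<lambda>k. w k j))"
proof -
  assume j: "j \<in> {1..n-1}"
  obtain w' x' where sol: "solution w' x'" using solvable by blast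
  have "norm (w k j) \<le> sqrt (dist2 w' 0) + norm (w' j)" for k
  proof -
    have "(norm (w k j - w' j))\<^sup>2 \<le> dist2 w' k"
      unfolding dist2_def using j by (intro member_le_sum) auto
    also have "\<dots> \<le> dist2 w' 0" using decseq_dist2[OF sol] by (simp add: decseq_def)
    finally have "norm (w k j - w' j) \<le> sqrt (dist2 w' 0)" by (rule real_le_rsqrt)
    then show ?thesis using norm_triangle_sub[of "w k j" "w' j"] by simp
  qed
  then show ?thesis by (rule bounded_rangeI)
qed

lemma bounded_lift: "bounded (range (\<lambda>k. lift (w k) i))"
  unfolding lift_def by (intro bounded_range_sum bounded_scaleR_comp bounded_w)

text \<open>Node \<open>1\<close> is controlled by its Lipschitz dependence on \<open>w\<close>, the
  others by their vanishing difference from it.\<close>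

lemma bounded_x: "i \<in> {1..n} \<Longrightarrow> bounded (range (\<lambda>k. x k i))"
proof -
  assume i: "i \<in> {1..n}"
  obtain w' x' a' where sol: "state w' (\<lambda>_. x') a'" using solvable by (auto simp: solution_def)
  obtain K where K: "\<And>k. norm (lift (w k) 1) \<le> K" using bounded_lift[of 1] bounded_rangeE by blast
  let ?d = "real (node_degree G 1)"
  have "norm (x k 1) \<le> (K + norm (lift w' 1)) / ?d + norm x'" for k
  proof -
    have "norm (x k 1 - x') * ?d \<le> K + norm (lift w' 1)"
      using first_node_lipschitz[OF state[of k] sol] K[of k] norm_triangle_ineq4[of "lift (w k) 1" "lift w' 1"]
      by (simp add: mult.commute)
    then have "norm (x k 1 - x') \<le> (K + norm (lift w' 1)) / ?d"
      using degree_pos[OF one_in_nodes] by (simp add: pos_le_divide_eq)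
    then show ?thesis using norm_triangle_sub[of "x k 1" x'] by simp
  qed
  then have "bounded (range (\<lambda>k. x k 1))" by (rule bounded_rangeI)
  moreover have "bounded (range (\<lambda>k. x k i - x k 1))"
    by (rule convergent_imp_bounded[OF node_difference_tendsto_0[OF i one_in_nodes]])
  ultimately have "bounded (range (\<lambda>k. (x k i - x k 1) + x k 1))"
    by (rule bounded_plus_comp[rotated])
  then show ?thesis by simp
qed

lemma bounded_C:
  assumes i: "i \<in> {1..n}"
  shows "bounded (range (\<lambda>k. C i (x k (q i))))"
proof -
  obtain K where K: "\<And>k. norm (x k (q i)) \<le> K"
    using bounded_x[OF q_in[OF i]] bounded_rangeE by blast
  have "norm (C i (x k (q i))) \<le> K / \<beta> + norm (C i 0)" for k
  proof -
    have "norm (C i (x k (q i)) - C i 0) * \<beta> \<le> K"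
      using cocoercive_lipschitz[OF C[OF i], of "x k (q i)" 0] K[of k] by (simp add: mult.commute)
    then have "norm (C i (x k (q i)) - C i 0) \<le> K / \<beta>"
      using beta by (simp add: pos_le_divide_eq)
    then show ?thesis using norm_triangle_sub[of "C i (x k (q i))" "C i 0"] by simp
  qed
  then show ?thesis by (rule bounded_rangeI)
qed

lemma a_eq:
  assumes "i \<in> {1..n}"
  shows "a k i = (1 / \<gamma>) *\<^sub>R (flow (x k) i - \<gamma> *\<^sub>R C i (x k (q i)) + lift (w k) i)"
proof -
  have "\<gamma> *\<^sub>R a k i = flow (x k) i - \<gamma> *\<^sub>R C i (x k (q i)) + lift (w k) i"
    using state[of k] assms by (simp only: state_def)
  from arg_cong[OF this, of "\<lambda>v. (1 / \<gamma>) *\<^sub>R v"] show ?thesis using gamma(1) by simp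
qed

lemma bounded_a:
  assumes i: "i \<in> {1..n}"
  shows "bounded (range (\<lambda>k. a k i))"
  unfolding a_eq[OF i] flow_def
proof (intro bounded_scaleR_comp bounded_plus_comp bounded_minus_comp bounded_range_sum bounded_lift
    bounded_C i bounded_x)
  show "h \<in> {1..n}" if "h \<in> {h. (h, i) \<in> parcs G}" for h using that arcs_G by auto
qed

text \<open>Weak limits pass through the linear state equation, which defines \<open>a'\<close>.
  That \<open>a' i\<close> lies in \<open>A i x'\<close> and that \<open>c' i\<close> is
  \<open>C i x'\<close> both follow from demiclosedness, applied to all these operators at
  once.\<close>

lemma cluster_point:
  assumes F: "F \<le> sequentially" "F \<noteq> bot"
  shows "\<exists>F' w' x'. F' \<le> F \<and> F' \<noteq> bot \<and> solution w' x' \<and>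
    (\<forall>j\<in>{1..n-1}. weak_limit (\<lambda>k. w k j) (w' j) F') \<and>
    (\<forall>i\<in>{1..n}. weak_limit (\<lambda>k. x k i) x' F')"
proof -
  have "\<forall>j\<in>{1..n-1}. \<exists>K. \<forall>k. norm (w k j) \<le> K"
    using bounded_w by (meson bounded_rangeE)
  then obtain K where K: "\<And>j k. j \<in> {1..n-1} \<Longrightarrow> norm (w k j) \<le> K j" by metis
  obtain F1 w' where F1: "F1 \<le> F" "F1 \<noteq> bot" "\<forall>j\<in>{1..n-1}. weak_limit (\<lambda>k. w k j) (w' j) F1"
    using weak_limit_exists_finite[of "{1..n-1}" F "\<lambda>j k. w k j" K] F(2) K by blast
  have "\<forall>i\<in>{1..n}. \<exists>K. \<forall>k. norm (C i (x k (q i))) \<le> K"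
    using bounded_C by (meson bounded_rangeE)
  then obtain L where L: "\<And>i k. i \<in> {1..n} \<Longrightarrow> norm (C i (x k (q i))) \<le> L i" by metis
  obtain F2 c' where F2: "F2 \<le> F1" "F2 \<noteq> bot" "\<forall>i\<in>{1..n}. weak_limit (\<lambda>k. C i (x k (q i))) (c' i) F2"
    using weak_limit_exists_finite[of "{1..n}" F1 "\<lambda>i k. C i (x k (q i))" L] F1(2) L by blast
  obtain M where M: "\<And>k. norm (x k 1) \<le> M" using bounded_x[OF one_in_nodes] bounded_rangeE by blast
  obtain F' x' where F': "F' \<le> F2" "F' \<noteq> bot" "weak_limit (\<lambda>k. x k 1) x' F'"
    using weak_limit_exists[OF F2(2), of "\<lambda>k. x k 1" M] M by blast
  have le: "F' \<le> F" "F' \<le> F1" "F' \<le> sequentially" using F F1 F2 F' by auto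
  have lim_w: "weak_limit (\<lambda>k. w k j) (w' j) F'" if "j \<in> {1..n-1}" for j
    using F1(3) that le(2) weak_limit_mono by blast
  have lim_c: "weak_limit (\<lambda>k. C i (x k (q i))) (c' i) F'" if "i \<in> {1..n}" for i
    using F2(3) that F'(1) weak_limit_mono by blast
  have diff: "((\<lambda>k. x k h - x k i) \<longlongrightarrow> 0) F'" if "h \<in> {1..n}" "i \<in> {1..n}" for h i
    using node_difference_tendsto_0[OF that] le(3) by (rule tendsto_mono[rotated])
  have lim_x: "weak_limit (\<lambda>k. x k i) x' F'" if i: "i \<in> {1..n}" for i
    using weak_limit_add[OF tendsto_imp_weak_limit[OF diff[OF i one_in_nodes]] F'(3)] by simp
  define a' where "a' = (\<lambda>i. (1 / \<gamma>) *\<^sub>R (flow (\<lambda>_. x') i - \<gamma> *\<^sub>R c' i + lift w' i))"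
  have lim_a: "weak_limit (\<lambda>k. a k i) (a' i) F'" if i: "i \<in> {1..n}" for i
    unfolding a_eq[OF i] a'_def flow_def lift_def
    using arcs_G
    by (intro weak_limit_scaleR weak_limit_add weak_limit_diff weak_limit_sum lim_x lim_w lim_c i) auto
  have balance': "(\<Sum>i=1..n. a' i) + (\<Sum>i=1..n. c' i) = 0"
  proof -
    have "\<gamma> *\<^sub>R ((\<Sum>i=1..n. a' i) + (\<Sum>i=1..n. c' i)) = (\<Sum>(h, i)\<in>parcs G. x' - x')"
      by (rule balance[of a' "\<lambda>_. x'" c' w']) (use gamma(1) in \<open>simp add: a'_def\<close>)
    then show ?thesis using gamma(1) by (simp add: case_prod_unfold)
  qed
  \<comment> \<open>The balance identity gives strong convergence here, since it expresses the total
    through arc differences.\<close>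
  have balance_lim: "((\<lambda>k. (\<Sum>i=1..n. a k i) + (\<Sum>i=1..n. C i (x k (q i)))) \<longlongrightarrow> 0) F'"
  proof -
    have eq: "(\<Sum>i=1..n. a k i) + (\<Sum>i=1..n. C i (x k (q i))) =
        (1 / \<gamma>) *\<^sub>R (\<Sum>(h, i)\<in>parcs G. x k h - x k i)" for k
    proof -
      have "\<gamma> *\<^sub>R ((\<Sum>i=1..n. a k i) + (\<Sum>i=1..n. C i (x k (q i)))) = (\<Sum>(h, i)\<in>parcs G. x k h - x k i)"
        using state[of k] by (intro balance[of "a k" "x k" _ "w k"]) (simp only: state_def)
      from arg_cong[OF this, of "\<lambda>v. (1 / \<gamma>) *\<^sub>R v"] show ?thesis using gamma(1) by simp
    qed
    have "((\<lambda>k. \<Sum>(h, i)\<in>parcs G. x k h - x k i) \<longlongrightarrow> (\<Sum>(h, i)\<in>parcs G. 0)) F'"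
      unfolding case_prod_unfold using arcs_G by (intro tendsto_sum diff) auto
    then have "((\<lambda>k. (1 / \<gamma>) *\<^sub>R (\<Sum>(h, i)\<in>parcs G. x k h - x k i)) \<longlongrightarrow> (1 / \<gamma>) *\<^sub>R 0) F'"
      by (intro tendsto_scaleR tendsto_const) (simp add: case_prod_unfold)
    then show ?thesis unfolding eq by simp
  qed
  \<comment> \<open>The left copy carries the \<open>A i\<close>, evaluated at \<open>x k i\<close>,
    the right copy the \<open>C i\<close>, evaluated at \<open>x k (q i)\<close>; all these points
    share the weak limit \<open>x'\<close>.\<close>
  define I where "I = {1..n} <+> {1..n}"
  define Mop where "Mop = case_sum A (\<lambda>i y. {C i y})"
  define u where "u = case_sum (\<lambda>i k. a k i) (\<lambda>i k. C i (x k (q i)))"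
  define z where "z = case_sum (\<lambda>i k. x k i) (\<lambda>i k. x k (q i))"
  define u' where "u' = case_sum a' c'"
  have sum_I: "(\<Sum>i\<in>I. f i) = (\<Sum>i=1..n. f (Inl i)) + (\<Sum>i=1..n. f (Inr i))" for f :: "nat + nat \<Rightarrow> real"
    unfolding I_def by (simp add: sum.Plus)
  have demiclosed: "u' j \<in> Mop j x'" if "j \<in> I" for j
  proof (rule maximally_monotone_demiclosed[where I = I and M = Mop and F = F' and u = u and z = z
        and z' = "\<lambda>_. x'"])
    show "finite I" by (simp add: I_def)
    show "maximally_monotone (Mop i)" if "i \<in> I" for i
      using that A cocoercive_maximally_monotone[OF C beta] by (auto simp: I_def Mop_def)
    show "u i k \<in> Mop i (z i k)" if "i \<in> I" for i k
      using that state[of k] by (auto simp: I_def Mop_def u_def z_def state_def)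
    show "weak_limit (u i) (u' i) F'" if "i \<in> I" for i
      using that lim_a lim_c by (auto simp: I_def u_def u'_def)
    show "weak_limit (z i) x' F'" if "i \<in> I" for i
      using that lim_x q_in by (auto simp: I_def z_def)
    \<comment> \<open>Relative to the base point \<open>x k 1\<close>, each pairing is a bounded
      sequence against a null sequence; the base point itself is paired with the vanishing
      balance.\<close>
    have split: "(\<Sum>i\<in>I. inner (u i k) (z i k)) =
        (\<Sum>i=1..n. inner (a k i) (x k i - x k 1)) + (\<Sum>i=1..n. inner (C i (x k (q i))) (x k (q i) - x k 1))
        + inner (x k 1) ((\<Sum>i=1..n. a k i) + (\<Sum>i=1..n. C i (x k (q i))))" for k
      by (simp add: sum_I u_def z_def inner_diff_right sum_subtractf inner_add_right inner_sum_right inner_commute)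
    have "((\<lambda>k. \<Sum>i\<in>I. inner (u i k) (z i k)) \<longlongrightarrow> (\<Sum>i=1..n. 0) + (\<Sum>i=1..n. 0) + 0) F'"
      unfolding split
    proof (intro tendsto_add tendsto_sum)
      fix i assume i: "i \<in> {1..n}"
      obtain K where "\<And>k. norm (a k i) \<le> K" using bounded_a[OF i] bounded_rangeE by blast
      then show "((\<lambda>k. inner (a k i) (x k i - x k 1)) \<longlongrightarrow> 0) F'"
        by (rule tendsto_inner_bounded_null) (rule diff[OF i one_in_nodes])
      show "((\<lambda>k. inner (C i (x k (q i))) (x k (q i) - x k 1)) \<longlongrightarrow> 0) F'"
        by (rule tendsto_inner_bounded_null[OF L[OF i]]) (rule diff[OF q_in[OF i] one_in_nodes])
    next
      show "((\<lambda>k. inner (x k 1) ((\<Sum>i=1..n. a k i) + (\<Sum>i=1..n. C i (x k (q i))))) \<longlongrightarrow> 0) F'"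
        by (rule tendsto_inner_bounded_null[OF M balance_lim])
    qed
    moreover have "(\<Sum>i\<in>I. inner (u' i) x') = inner ((\<Sum>i=1..n. a' i) + (\<Sum>i=1..n. c' i)) x'"
      by (simp add: sum_I u'_def inner_add_left inner_sum_left)
    then have "(\<Sum>i\<in>I. inner (u' i) x') = 0" by (simp only: balance' inner_zero_left)
    ultimately show "((\<lambda>k. \<Sum>i\<in>I. inner (u i k) (z i k)) \<longlongrightarrow> (\<Sum>i\<in>I. inner (u' i) x')) F'"
      by simp
  qed (use F' that in auto)
  have "state w' (\<lambda>_. x') a'"
    unfolding state_def
  proof (intro ballI conjI)
    fix i assume i: "i \<in> {1..n}"
    then have "Inl i \<in> I" "Inr i \<in> I" by (simp_all only: I_def InlI InrI)
    from this[THEN demiclosed] have mem: "a' i \<in> A i x'" and "c' i = C i x'"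
      by (simp_all add: u'_def Mop_def)
    show "a' i \<in> A i x'" by (rule mem)
    show "\<gamma> *\<^sub>R a' i = flow (\<lambda>_. x') i - \<gamma> *\<^sub>R C i x' + lift w' i"
      using gamma(1) \<open>c' i = C i x'\<close> by (simp add: a'_def)
  qed
  then have "solution w' x'" unfolding solution_def by blast
  with le(1) F'(2) show ?thesis
    by (intro exI[of _ F'] exI[of _ w'] exI[of _ x'] conjI ballI lim_w lim_x)
qed

section \<open>Uniqueness of the weak cluster point\<close>

lemma dist2_convergent:
  assumes "solution w' x'"
  shows "convergent (dist2 w')"
proof -
  have "\<forall>k. 0 \<le> dist2 w' k" by (simp add: dist2_nonneg)
  then obtain l where "dist2 w' \<longlonglongrightarrow> l"
    using decseq_convergent[OF decseq_dist2[OF assms]] by metis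
  then show ?thesis by (rule convergentI)
qed

text \<open>Opial's argument: the difference of the squared distances to two solutions is affine in
  \<open>w k\<close> and converges, so it takes the same value at all weak cluster points.\<close>

lemma cluster_point_unique:
  assumes sol: "solution u xu" "solution v xv"
    and F: "F \<le> sequentially" "F \<noteq> bot" and F': "F' \<le> sequentially" "F' \<noteq> bot"
    and u: "\<And>j. j \<in> {1..n-1} \<Longrightarrow> weak_limit (\<lambda>k. w k j) (u j) F"
    and v: "\<And>j. j \<in> {1..n-1} \<Longrightarrow> weak_limit (\<lambda>k. w k j) (v j) F'"
    and j: "j \<in> {1..n-1}"
  shows "u j = v j"
proof -
  define g where "g = (\<lambda>k. \<Sum>j=1..n-1. inner (w k j) (u j - v j))"
  define s where "s = (\<Sum>j=1..n-1. (norm (u j))\<^sup>2 - (norm (v j))\<^sup>2)"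
  have g_eq: "g = (\<lambda>k. (dist2 v k - dist2 u k + s) / 2)"
  proof
    fix k
    have "dist2 v k - dist2 u k + s = (\<Sum>j=1..n-1. 2 * inner (w k j) (u j - v j))"
      unfolding dist2_def s_def sum_subtractf[symmetric] sum.distrib[symmetric]
      by (intro sum.cong refl)
        (simp add: power2_norm_eq_inner inner_diff_left inner_diff_right inner_commute)
    then show "g k = (dist2 v k - dist2 u k + s) / 2"
      by (simp add: g_def flip: sum_distrib_left)
  qed
  obtain lu lv where "dist2 u \<longlonglongrightarrow> lu" "dist2 v \<longlonglongrightarrow> lv"
    using dist2_convergent sol unfolding convergent_def by blast
  then have g: "g \<longlonglongrightarrow> (lv - lu + s) / 2"
    unfolding g_eq by (intro tendsto_intros) auto
  have gu: "(g \<longlongrightarrow> (\<Sum>j=1..n-1. inner (u j) (u j - v j))) F"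
    unfolding g_def using u by (intro tendsto_sum) (auto simp: weak_limit_def)
  have gv: "(g \<longlongrightarrow> (\<Sum>j=1..n-1. inner (v j) (u j - v j))) F'"
    unfolding g_def using v by (intro tendsto_sum) (auto simp: weak_limit_def)
  have "(\<Sum>j=1..n-1. inner (u j) (u j - v j)) = (\<Sum>j=1..n-1. inner (v j) (u j - v j))"
    using tendsto_unique[OF F(2) gu tendsto_mono[OF F(1) g]]
      tendsto_unique[OF F'(2) gv tendsto_mono[OF F'(1) g]] by simp
  then have "(\<Sum>j=1..n-1. inner (u j - v j) (u j - v j)) = 0"
    by (simp only: inner_diff_left sum_subtractf)
  then have "inner (u j - v j) (u j - v j) = 0"
    using j by (subst (asm) sum_nonneg_eq_0_iff) auto
  then show ?thesis by simp
qed

text \<open>By the Lipschitz bound at node \<open>1\<close>, \<open>w\<close> determines the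
  point.\<close>

lemma solution_unique_point:
  assumes "solution w' x'" "solution v y" and eq: "\<And>j. j \<in> {1..n-1} \<Longrightarrow> w' j = v j"
  shows "x' = y"
proof -
  have "lift w' 1 = lift v 1" unfolding lift_def using eq by (intro sum.cong) auto
  then have "real (node_degree G 1) * norm (x' - y) \<le> 0"
    using assms(1,2) first_node_lipschitz unfolding solution_def by fastforce
  then show ?thesis using degree_pos[OF one_in_nodes] by (simp add: mult_le_0_iff)
qed

lemma weak_convergence:
  "\<exists>w' x'. solution w' x' \<and> (\<forall>j\<in>{1..n-1}. weakly_tendsto (\<lambda>k. w k j) (w' j)) \<and>
    (\<forall>i\<in>{1..n}. weakly_tendsto (\<lambda>k. x k i) x')"
proof -
  obtain F0 w' x' where 0: "F0 \<le> sequentially" "F0 \<noteq> bot" "solution w' x'"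
    "\<forall>j\<in>{1..n-1}. weak_limit (\<lambda>k. w k j) (w' j) F0"
    using cluster_point[OF order_refl trivial_limit_sequentially] by blast
  \<comment> \<open>Each proper filter finer than \<open>sequentially\<close> has a refinement along
    which the iterates converge weakly to a solution; uniqueness identifies it with the one found
    along \<open>F0\<close>.\<close>
  have key: "\<exists>F'\<le>F. F' \<noteq> bot \<and> (\<forall>j\<in>{1..n-1}. weak_limit (\<lambda>k. w k j) (w' j) F') \<and>
      (\<forall>i\<in>{1..n}. weak_limit (\<lambda>k. x k i) x' F')"
    if F: "F \<le> sequentially" "F \<noteq> bot" for F
  proof -
    obtain F' v y where F': "F' \<le> F" "F' \<noteq> bot" "solution v y"
      "\<forall>j\<in>{1..n-1}. weak_limit (\<lambda>k. w k j) (v j) F'" "\<forall>i\<in>{1..n}. weak_limit (\<lambda>k. x k i) y F'"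
      using cluster_point[OF F] by blast
    have eq: "w' j = v j" if "j \<in> {1..n-1}" for j
      using cluster_point_unique[OF 0(3) F'(3) 0(1,2) order_trans[OF F'(1) F(1)] F'(2)] 0(4) F'(4) that
      by blast
    then have "x' = y" by (rule solution_unique_point[OF 0(3) F'(3)])
    then show ?thesis using F' eq by (intro exI[of _ F']) simp
  qed
  have "weakly_tendsto (\<lambda>k. w k j) (w' j)" if "j \<in> {1..n-1}" for j
    using key that by (intro weakly_tendstoI_subfilter) blast
  moreover have "weakly_tendsto (\<lambda>k. x k i) x'" if "i \<in> {1..n}" for i
    using key that by (intro weakly_tendstoI_subfilter) blast
  ultimately show ?thesis using 0(3) by blast
qed

end

section \<open>From resolvent equations to states and back\<close>

theorem theorem4p1:
  fixes n :: nat and \<beta> \<gamma> :: real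
    and A :: "nat \<Rightarrow> 'a::{real_inner, complete_space} operator"
    and B :: "nat \<Rightarrow> 'a \<Rightarrow> 'a"
    and G G' G'' :: "nat pair_pre_digraph"
    and p :: "nat \<Rightarrow> nat"
    and Z :: "real mat"
    and \<theta> :: "nat \<Rightarrow> real"
    and x w :: "nat \<Rightarrow> nat \<Rightarrow> 'a"
  defines "T \<equiv> \<lambda>y. (\<Sum>i=1..n. A i y) + (\<Sum>j=1..n-1. {B j y})"
  assumes n: "n \<ge> 2" and beta: "\<beta> > 0"
    and A: "\<And>i. i \<in> {1..n} \<Longrightarrow> maximally_monotone (A i)"
    and B: "\<And>j. j \<in> {1..n-1} \<Longrightarrow> cocoercive \<beta> (B j)"
    and zer: "zer T \<noteq> {}"
    and G: "algorithmic_graph n G"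
    and G': "digraph_on n G'" "parcs G' \<subseteq> parcs G" "Digraph_Component.connected (with_proj G')"
    and G'': "digraph_on n G''" "parcs G'' \<subseteq> parcs G"
    and p: "\<And>i. i \<in> {2..n} \<Longrightarrow> {h. (h, i) \<in> parcs G''} = {p i}"
    and Z: "onto_decomposition n G' Z"
    and gamma: "\<gamma> \<in> {0<..<4 * \<beta>}"
    and theta: "\<And>k. \<theta> k \<in> {0<..(4 * \<beta> - \<gamma>) / (2 * \<beta>)}"
    and theta_sum:
      "filterlim (\<lambda>N. \<Sum>k<N. \<theta> k * ((4 * \<beta> - \<gamma>) / (2 * \<beta>) - \<theta> k)) at_top sequentially"
    and x1: "\<And>k. x (Suc k) 1 =
        resolvent (op_scale (\<gamma> / node_degree G 1) (A 1))
          ((1 / node_degree G 1) *\<^sub>R (\<Sum>j=1..n-1. entry Z 1 j *\<^sub>R w k j))"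
    and xi: "\<And>k i. i \<in> {2..n} \<Longrightarrow> x (Suc k) i =
        resolvent (op_scale (\<gamma> / node_degree G i) (A i))
          ((2 / node_degree G i) *\<^sub>R (\<Sum>h | (h, i) \<in> parcs G. x (Suc k) h)
            - (\<gamma> / node_degree G i) *\<^sub>R B (i - 1) (x (Suc k) (p i))
            + (1 / node_degree G i) *\<^sub>R (\<Sum>j=1..n-1. entry Z i j *\<^sub>R w k j))"
    and w: "\<And>k i. i \<in> {1..n-1} \<Longrightarrow>
        w (Suc k) i = w k i - \<theta> k *\<^sub>R (\<Sum>j=1..n. entry Z j i *\<^sub>R x (Suc k) j)"
  shows "\<exists>w_lim.
      (\<forall>j\<in>{1..n-1}. weakly_tendsto (\<lambda>k. w k j) (w_lim j)) \<and>
      (\<exists>x_lim \<in> zer T.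
        (\<forall>i\<in>{1..n}. weakly_tendsto (\<lambda>k. x (Suc k) i) x_lim) \<and>
        x_lim = resolvent (op_scale (\<gamma> / node_degree G 1) (A 1))
          ((1 / node_degree G 1) *\<^sub>R (\<Sum>j=1..n-1. entry Z 1 j *\<^sub>R w_lim j)) \<and>
        (\<forall>i\<in>{2..n}. x_lim = resolvent (op_scale (\<gamma> / node_degree G i) (A i))
          ((2 * in_degree (with_proj G) i / node_degree G i) *\<^sub>R x_lim
            - (\<gamma> / node_degree G i) *\<^sub>R B (i - 1) x_lim
            + (1 / node_degree G i) *\<^sub>R (\<Sum>j=1..n-1. entry Z i j *\<^sub>R w_lim j))))"
proof -
  define q where "q = (\<lambda>i. if i = 1 then 1 else p i)"
  define C where "C = (\<lambda>i. if i = 1 then (\<lambda>_. 0) else B (i - 1))"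
  have C_Suc: "C (Suc j) = B j" if "j \<in> {1..n-1}" for j
    using that by (simp add: C_def)
  have sum_C: "(\<Sum>i=1..n. C i y) = (\<Sum>j=1..n-1. B j y)" for y
  proof -
    have "(\<Sum>i=1..n. C i y) = C 1 y + (\<Sum>i=Suc 1..n. C i y)"
      using n by (intro sum.atLeast_Suc_atMost) simp
    also have "(\<Sum>i=Suc 1..n. C i y) = (\<Sum>j=1..n-1. B j y)"
      using C_Suc by (intro sum.reindex_bij_witness[of _ Suc "\<lambda>i. i - 1"]) (auto simp: C_def)
    finally show ?thesis by (simp add: C_def)
  qed
  \<comment> \<open>A zero of \<open>T\<close> is thus a choice of elements of the
    \<open>A i y\<close> balanced by the values \<open>C i y\<close>, the form that solutions
    produce and consume.\<close>
  have T_eq: "T y = {(\<Sum>i=1..n. s i) + (\<Sum>i=1..n. C i y) | s. \<forall>i\<in>{1..n}. s i \<in> A i y}" for y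
  proof -
    have "(\<Sum>j=1..n-1. {B j y}) = {\<Sum>j=1..n-1. B j y}"
      unfolding set_sum_alt[OF finite_atLeastAtMost] by auto
    then show ?thesis
      unfolding T_def set_sum_alt[OF finite_atLeastAtMost] sum_C by (auto simp: set_plus_def)
  qed
  have orient: "i < j" if "(i, j) \<in> parcs G" for i j
    using G that by (auto simp: algorithmic_graph_def)
  have cocoercive_C: "cocoercive \<beta> (C i)" if "i \<in> {1..n}" for i
  proof (cases "i = 1")
    case False
    then have "i - 1 \<in> {1..n-1}" using that by auto
    then show ?thesis using B False by (simp add: C_def)
  qed (simp add: C_def cocoercive_def)
  have q: "q i = i \<or> (q i, i) \<in> parcs G" if "i \<in> {1..n}" for i
  proof (cases "i = 1")
    case False
    then have "(p i, i) \<in> parcs G''" using p[of i] that by auto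
    then show ?thesis using G''(2) False by (auto simp: q_def)
  qed (simp add: q_def)
  interpret graph_splitting n G' Z G q \<beta> \<gamma> A C
    using G G' Z A cocoercive_C q beta gamma orient by unfold_locales auto
  have degree_1: "real (node_degree G 1) > 0" by (rule degree_pos[OF one_in_nodes])
  \<comment> \<open>Multiplication by the positive degree turns the resolvent inclusion into the
    state equation. Node \<open>1\<close> is separate because its resolvent argument consists of the
    lift alone.\<close>
  have first_iff: "y = resolvent (op_scale (\<gamma> / node_degree G 1) (A 1)) ((1 / node_degree G 1) *\<^sub>R lift v 1)
      \<longleftrightarrow> (\<exists>a\<in>A 1 y. \<gamma> *\<^sub>R a = - (real (node_degree G 1) *\<^sub>R y) + lift v 1)" for y v
  proof -
    let ?d = "real (node_degree G 1)"
    have "(\<gamma> / ?d) *\<^sub>R a = (1 / ?d) *\<^sub>R lift v 1 - y \<longleftrightarrow> \<gamma> *\<^sub>R a = - (?d *\<^sub>R y) + lift v 1" for a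
    proof -
      have "(\<gamma> / ?d) *\<^sub>R a = (1 / ?d) *\<^sub>R lift v 1 - y
          \<longleftrightarrow> ?d *\<^sub>R ((\<gamma> / ?d) *\<^sub>R a) = ?d *\<^sub>R ((1 / ?d) *\<^sub>R lift v 1 - y)"
        using degree_1 by (subst scaleR_cancel_left) simp
      then show ?thesis using degree_1 by (simp add: scaleR_diff_right)
    qed
    then show ?thesis
      using resolvent_eq_iff[OF A[OF one_in_nodes], of "\<gamma> / ?d" y] degree_1 gamma by simp
  qed
  \<comment> \<open>With \<open>s\<close> and \<open>b\<close> free, one equivalence serves both the
    sweeps and the limit equation.\<close>
  have node_iff: "y = resolvent (op_scale (\<gamma> / node_degree G i) (A i))
        ((2 / node_degree G i) *\<^sub>R s - (\<gamma> / node_degree G i) *\<^sub>R b + (1 / node_degree G i) *\<^sub>R lift v i)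
      \<longleftrightarrow> (\<exists>a\<in>A i y. \<gamma> *\<^sub>R a = 2 *\<^sub>R s - real (node_degree G i) *\<^sub>R y - \<gamma> *\<^sub>R b + lift v i)"
    if i: "i \<in> {1..n}" for i y s b v
  proof -
    let ?d = "real (node_degree G i)"
    have d: "?d > 0" by (rule degree_pos[OF i])
    have "(\<gamma> / ?d) *\<^sub>R a = (2 / ?d) *\<^sub>R s - (\<gamma> / ?d) *\<^sub>R b + (1 / ?d) *\<^sub>R lift v i - y
        \<longleftrightarrow> \<gamma> *\<^sub>R a = 2 *\<^sub>R s - ?d *\<^sub>R y - \<gamma> *\<^sub>R b + lift v i" for a
    proof -
      have "(\<gamma> / ?d) *\<^sub>R a = (2 / ?d) *\<^sub>R s - (\<gamma> / ?d) *\<^sub>R b + (1 / ?d) *\<^sub>R lift v i - y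
          \<longleftrightarrow> ?d *\<^sub>R ((\<gamma> / ?d) *\<^sub>R a) =
            ?d *\<^sub>R ((2 / ?d) *\<^sub>R s - (\<gamma> / ?d) *\<^sub>R b + (1 / ?d) *\<^sub>R lift v i - y)"
        using d by (subst scaleR_cancel_left) simp
      then show ?thesis using d by (simp add: scaleR_diff_right scaleR_add_right algebra_simps)
    qed
    then show ?thesis
      using resolvent_eq_iff[OF A[OF i], of "\<gamma> / ?d" y] d gamma by simp
  qed
  have "\<exists>a. state (w k) (x (Suc k)) a" for k
  proof -
    have "\<exists>a\<in>A i (x (Suc k) i). \<gamma> *\<^sub>R a = flow (x (Suc k)) i - \<gamma> *\<^sub>R C i (x (Suc k) (q i)) + lift (w k) i"
      if i: "i \<in> {1..n}" for i
    proof (cases "i = 1")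
      case True
      then show ?thesis
        using x1[of k] unfolding True flow_first lift_def[symmetric] first_iff by (simp add: C_def)
    next
      case False
      then have "i \<in> {2..n}" using i by auto
      from xi[OF this, of k] show ?thesis
        unfolding lift_def[symmetric] node_iff[OF i] using False by (simp add: C_def q_def flow_def)
    qed
    then show ?thesis unfolding state_def by metis
  qed
  then obtain a where a: "\<And>k. state (w k) (x (Suc k)) (a k)" by metis
  have "\<exists>w\<^sub>0 x\<^sub>0. solution w\<^sub>0 x\<^sub>0"
  proof -
    obtain y where "0 \<in> T y" using zer by (auto simp: zer_def)
    then obtain s where s: "\<forall>i\<in>{1..n}. s i \<in> A i y" "(\<Sum>i=1..n. s i) + (\<Sum>i=1..n. C i y) = 0"
      unfolding T_eq by (smt (verit) mem_Collect_eq)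
    then show ?thesis using zero_imp_solution[of s y] by blast
  qed
  then interpret graph_splitting_iteration n G' Z G q \<beta> \<gamma> A C w "\<lambda>k. x (Suc k)" a \<theta>
    using a w theta theta_sum by unfold_locales (auto simp: residual_def)
  obtain w' x' where sol: "solution w' x'"
    and w': "\<forall>j\<in>{1..n-1}. weakly_tendsto (\<lambda>k. w k j) (w' j)"
    and x': "\<forall>i\<in>{1..n}. weakly_tendsto (\<lambda>k. x (Suc k) i) x'"
    using weak_convergence by blast
  obtain b where b: "state w' (\<lambda>_. x') b" using sol by (auto simp: solution_def)
  have "x' \<in> zer T"
    using solution_imp_zero[OF sol] unfolding zer_def T_eq by force
  moreover have "x' = resolvent (op_scale (\<gamma> / node_degree G 1) (A 1))
      ((1 / node_degree G 1) *\<^sub>R (\<Sum>j=1..n-1. entry Z 1 j *\<^sub>R w' j))"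
    unfolding lift_def[symmetric] first_iff
    using b one_in_nodes flow_first[of "\<lambda>_. x'"] unfolding state_def by (force simp: C_def)
  moreover have "x' = resolvent (op_scale (\<gamma> / node_degree G i) (A i))
      ((2 * in_degree (with_proj G) i / node_degree G i) *\<^sub>R x' - (\<gamma> / node_degree G i) *\<^sub>R B (i - 1) x'
        + (1 / node_degree G i) *\<^sub>R (\<Sum>j=1..n-1. entry Z i j *\<^sub>R w' j))" if "i \<in> {2..n}" for i
  proof -
    have i: "i \<in> {1..n}" "i \<noteq> 1" using that by auto
    \<comment> \<open>When all nodes sit at \<open>x'\<close>, the sum over predecessors is the
      in-degree times \<open>x'\<close>.\<close>
    have eq: "(2 * in_degree (with_proj G) i / node_degree G i) *\<^sub>R x' =
        (2 / node_degree G i) *\<^sub>R (\<Sum>h | (h, i) \<in> parcs G. x')"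
      by (simp add: in_degree_with_proj sum_constant_scaleR)
    have "b i \<in> A i x'" "\<gamma> *\<^sub>R b i = flow (\<lambda>_. x') i - \<gamma> *\<^sub>R C i x' + lift w' i"
      using b i(1) unfolding state_def by blast+
    moreover from this(2) have "\<gamma> *\<^sub>R b i = 2 *\<^sub>R (\<Sum>h | (h, i) \<in> parcs G. x')
        - real (node_degree G i) *\<^sub>R x' - \<gamma> *\<^sub>R B (i - 1) x' + lift w' i"
      unfolding flow_def using i(2) by (simp only: C_def if_False)
    ultimately show ?thesis
      unfolding lift_def[symmetric] eq node_iff[OF i(1)] by blast
  qed
  ultimately show ?thesis using w' x' by blast
qed

end
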